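(* Let $(\mathcal M_k)_{k=1}^\infty$ be a sequence of compact, hereditary and spreading families of finite subsets of $\mathbb N$ and let $(\theta_k)_{k=1}^\infty$ be a sequence of positive reals with $\theta_k<1$ for every $k$. Suppose that $(\theta_k)_k$ decreases to $0$ and that the Schreier family $\mathcal S$ is contained in $\mathcal M_1$. Then the spaces $T_M[(\mathcal M_k,\theta_k)_{k=1}^\infty]$ and $T_{M(m)}[(\mathcal M_k,\theta_k)_{k=1}^\infty]$, $m=1,2,\dots$, are reflexive.
   Context: $\mathbb N=\{1,2,\dots\}$; $c_{00}$ is the space of finitely supported real sequences with standard basis $(e_i)$. The Schreier family is $\mathcal S=\{A\subset\mathbb N:\#A\le\min A\}$ (with $\emptyset\in\mathcal S$). A family $\mathcal M$ of finite subsets of $\mathbb N$ is compact if it is closed in the topology of pointwise convergence in $2^{\mathbb N}$; hereditary if $B\subset A\in\mathcal M$ implies $B\in\mathcal M$; spreading if $\{m_1,\dots,m_k\}\in\mathcal M$ and $m_i\le n_i$ for $i=1,\dots,k$ imply $\{n_1,\dots,n_k\}\in\mathcal M$ (elements listed in increasing order). A finite sequence $(E_i)_{i=1}^d$ of nonempty finite subsets of $\mathbb N$ with $\{\min E_1,\dots,\min E_d\}\in\mathcal M$ is $\mathcal M$-admissible if $\max E_i<\min E_{i+1}$ for $i<d$, and $\mathcal M$-allowable if the $E_i$ are pairwise disjoint. A sequence of finitely supported functionals is admissible/allowable if its sequence of supports is. The modified mixed Tsirelson space $T_M[(\mathcal M_k,\theta_k)_{k=1}^\infty]$ is the completion of $c_{00}$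 under $\|x\|=\sup_{f\in K}\langle x,f\rangle$, where $K$ is the smallest set of finitely supported functionals containing $\pm e_n$ for all $n$ and containing $\theta_k(f_1+\dots+f_d)$ whenever $k\ge1$, $f_1,\dots,f_d\in K$ and $(f_i)_{i=1}^d$ is $\mathcal M_k$-allowable. The boundedly modified space $T_{M(m)}[(\mathcal M_k,\theta_k)_{k=1}^\infty]$ is defined in the same way, with "$\mathcal M_k$-allowable" required for $k\le m$ and "$\mathcal M_k$-admissible" required for $k\ge m+1$. *)

theory Defs
  imports "HOL-Analysis.Analysis"
begin

text \<open>
  The index set is \<open>{1, 2, \<dots>}\<close>, modelled inside \<^typ>\<open>nat\<close>: sets of indices avoid \<open>0\<close> and
  sequences vanish at \<open>0\<close>. Sequences of families and of coefficients are likewise only used at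
  indices \<open>k \<ge> 1\<close>.
\<close>

section \<open>Families of finite sets\<close>

definition finite_family :: "nat set set \<Rightarrow> bool" where
  "finite_family \<M> \<longleftrightarrow> (\<forall>A\<in>\<M>. finite A \<and> 0 \<notin> A)"

text \<open>Closedness in \<open>2\<^sup>\<nat>\<close>: sets are identified with their characteristic functions, and
  \<^typ>\<open>nat \<Rightarrow> bool\<close> carries the product of the discrete topologies.\<close>
definition compact_family :: "nat set set \<Rightarrow> bool" where
  "compact_family \<M> \<longleftrightarrow> closed ((\<lambda>A n. n \<in> A) ` \<M>)"

definition hereditary :: "nat set set \<Rightarrow> bool" where
  "hereditary \<M> \<longleftrightarrow> (\<forall>A\<in>\<M>. \<forall>B. B \<subseteq> A \<longrightarrow> B \<in> \<M>)"

definition spreading :: "nat set set \<Rightarrow> bool" where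
  "spreading \<M> \<longleftrightarrow>
     (\<forall>ms ns. sorted_wrt (<) ms \<longrightarrow> sorted_wrt (<) ns \<longrightarrow> list_all2 (\<le>) ms ns \<longrightarrow>
        set ms \<in> \<M> \<longrightarrow> set ns \<in> \<M>)"

definition schreier :: "nat set set" where
  "schreier = {A. finite A \<and> 0 \<notin> A \<and> (A = {} \<or> card A \<le> Min A)}"

section \<open>Admissible and allowable sequences\<close>

text \<open>Sequences \<open>(E\<^sub>1, \<dots>, E\<^sub>d)\<close> with \<open>d \<ge> 1\<close> are lists.\<close>
definition min_in_family :: "nat set set \<Rightarrow> nat set list \<Rightarrow> bool" where
  "min_in_family \<M> Es \<longleftrightarrow>
     Es \<noteq> [] \<and> (\<forall>E\<in>set Es. finite E \<and> E \<noteq> {} \<and> 0 \<notin> E) \<and> Min ` set Es \<in> \<M>"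

definition admissible :: "nat set set \<Rightarrow> nat set list \<Rightarrow> bool" where
  "admissible \<M> Es \<longleftrightarrow> min_in_family \<M> Es \<and>
     (\<forall>i. Suc i < length Es \<longrightarrow> Max (Es ! i) < Min (Es ! Suc i))"

definition allowable :: "nat set set \<Rightarrow> nat set list \<Rightarrow> bool" where
  "allowable \<M> Es \<longleftrightarrow> min_in_family \<M> Es \<and>
     (\<forall>i j. i < j \<longrightarrow> j < length Es \<longrightarrow> Es ! i \<inter> Es ! j = {})"

section \<open>The norming sets and the norms\<close>

definition supp :: "(nat \<Rightarrow> real) \<Rightarrow> nat set" where
  "supp x = {n. x n \<noteq> 0}"

definition c00 :: "(nat \<Rightarrow> real) set" where
  "c00 = {x. finite (supp x) \<and> x 0 = 0}"

definition unit_vec :: "nat \<Rightarrow> nat \<Rightarrow> real" where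
  "unit_vec n = (\<lambda>i. if i = n then 1 else 0)"

text \<open>Finitely supported functionals are represented by their coefficient sequences.\<close>
definition pairing :: "(nat \<Rightarrow> real) \<Rightarrow> (nat \<Rightarrow> real) \<Rightarrow> real" where
  "pairing x f = (\<Sum>n\<in>supp f. x n * f n)"

text \<open>\<open>P k\<close> is the condition on the supports of \<open>f\<^sub>1, \<dots>, f\<^sub>d\<close> under which
  \<open>\<theta>\<^sub>k (f\<^sub>1 + \<dots> + f\<^sub>d)\<close> may be formed.\<close>
inductive_set norming_set :: "(nat \<Rightarrow> nat set list \<Rightarrow> bool) \<Rightarrow> (nat \<Rightarrow> real) \<Rightarrow> (nat \<Rightarrow> real) set"
  for P :: "nat \<Rightarrow> nat set list \<Rightarrow> bool" and \<theta> :: "nat \<Rightarrow> real" where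
  unit_pos: "n \<ge> 1 \<Longrightarrow> unit_vec n \<in> norming_set P \<theta>"
| unit_neg: "n \<ge> 1 \<Longrightarrow> (\<lambda>i. - unit_vec n i) \<in> norming_set P \<theta>"
| combine: "k \<ge> 1 \<Longrightarrow> (\<And>f. f \<in> set fs \<Longrightarrow> f \<in> norming_set P \<theta>) \<Longrightarrow> P k (map supp fs) \<Longrightarrow>
    (\<lambda>i. \<theta> k * (\<Sum>f\<leftarrow>fs. f i)) \<in> norming_set P \<theta>"

definition norm_by :: "(nat \<Rightarrow> real) set \<Rightarrow> (nat \<Rightarrow> real) \<Rightarrow> real" where
  "norm_by K x = (SUP f\<in>K. pairing x f)"

definition T_M_norm :: "(nat \<Rightarrow> nat set set) \<Rightarrow> (nat \<Rightarrow> real) \<Rightarrow> (nat \<Rightarrow> real) \<Rightarrow> real" where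
  "T_M_norm \<M> \<theta> = norm_by (norming_set (\<lambda>k. allowable (\<M> k)) \<theta>)"

definition T_Mm_norm ::
  "nat \<Rightarrow> (nat \<Rightarrow> nat set set) \<Rightarrow> (nat \<Rightarrow> real) \<Rightarrow> (nat \<Rightarrow> real) \<Rightarrow> real" where
  "T_Mm_norm m \<M> \<theta> =
     norm_by (norming_set (\<lambda>k. if k \<le> m then allowable (\<M> k) else admissible (\<M> k)) \<theta>)"

section \<open>Completions and reflexivity\<close>

text \<open>\<open>J\<close> exhibits the Banach space \<open>'x\<close> as the completion of \<^const>\<open>c00\<close> under the norm \<open>N\<close>.
  The completion is unique up to isometric isomorphism; as a type cannot depend on the parameters
  of \<open>N\<close>, it is described by this property. The values of \<open>J\<close> off \<^const>\<open>c00\<close> are irrelevant.\<close>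
definition is_completion :: "((nat \<Rightarrow> real) \<Rightarrow> real) \<Rightarrow> ((nat \<Rightarrow> real) \<Rightarrow> 'x::banach) \<Rightarrow> bool" where
  "is_completion N J \<longleftrightarrow>
     (\<forall>x\<in>c00. \<forall>y\<in>c00. J (\<lambda>n. x n + y n) = J x + J y) \<and>
     (\<forall>c. \<forall>x\<in>c00. J (\<lambda>n. c * x n) = c *\<^sub>R J x) \<and>
     (\<forall>x\<in>c00. norm (J x) = N x) \<and>
     closure (J ` c00) = UNIV"

definition canonical_embedding :: "'x::real_normed_vector \<Rightarrow> (('x \<Rightarrow>\<^sub>L real) \<Rightarrow>\<^sub>L real)" where
  "canonical_embedding x = Blinfun (\<lambda>f. blinfun_apply f x)"

lemma canonical_embedding_apply [simp]:
  "blinfun_apply (canonical_embedding x) f = blinfun_apply f x"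
  unfolding canonical_embedding_def
  by (simp add: bounded_linear_Blinfun_apply blinfun.bounded_linear_left)

definition reflexive :: "'x::real_normed_vector itself \<Rightarrow> bool" where
  "reflexive (_ :: 'x itself) \<longleftrightarrow> surj (canonical_embedding :: 'x \<Rightarrow> (('x \<Rightarrow>\<^sub>L real) \<Rightarrow>\<^sub>L real))"

end

theory Submission
  imports Defs
begin

text \<open>
  Let \<open>K\<close> be the norming set of either construction and \<open>N\<close> its norm. The unit vectors form an
  unconditional basis of the completion, and reflexivity follows as in the theorem of James from the
  basis being boundedly complete and shrinking.

  Both properties rest on the fact that \<open>\<M> 1\<close> contains the Schreier family and that
  \<open>\<M> 1\<close>-allowable sums may be formed: if \<open>d\<close> functionals of \<open>K\<close> have disjoint supports contained in
  \<open>{d..}\<close>, then \<open>\<theta> 1\<close> times their sum is in \<open>K\<close> (\<open>schreier_combine\<close>, \<open>schreier_estimate\<close>). Hence \<open>d\<close>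
  disjoint blocks of norm at least \<open>\<epsilon>\<close>, far enough out, have a sum of norm at least \<open>\<theta> 1 * d * \<epsilon>\<close>, so
  that bounded partial sums converge (\<open>boundedly_complete\<close>).

  For the shrinking property, consider the closure of \<open>K\<close> under pointwise convergence. By compactness
  of the families \<open>\<M> k\<close> and \<open>\<theta> k \<rightarrow> 0\<close>, a pointwise limit \<open>\<phi>\<close> that is not finitely supported is again
  \<open>\<theta> k\<close> times a \<^emph>\<open>finite\<close> sum of pointwise limits with disjoint supports (\<open>closure_level\<close>,
  \<open>closure_norming_decompose\<close>). Iterating \<open>s\<close> times writes \<open>\<phi>\<close>, up to a finitely supported part, as a
  finite disjoint sum with coefficients at most \<open>\<theta> 1 ^ s\<close>, and by the Schreier estimate the tails of such
  a sum have norm at most \<open>\<theta> 1 ^ s / \<theta> 1\<close> (\<open>tail_estimate\<close>). So the tails of every pointwise limit tend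
  to \<open>0\<close> in norm. The pointwise limits form a boundary: each vector attains its norm at one of them
  (\<open>boundary_attained\<close>). The sup-limsup principle of Simons (\<open>simons_sup_limsup\<close>) transfers the decay
  of tails from the boundary to all functionals (\<open>shrinking\<close>).
\<close>

section \<open>Spreading families and restrictions of allowable sequences\<close>

lemma sorted_list_of_set_image_le:
  fixes g :: "nat \<Rightarrow> nat"
  assumes "finite B" "inj_on g B" "\<And>b. b \<in> B \<Longrightarrow> g b \<le> b"
  shows "list_all2 (\<le>) (sorted_list_of_set (g ` B)) (sorted_list_of_set B)"
proof -
  let ?ms = "sorted_list_of_set (g ` B)" and ?ns = "sorted_list_of_set B"
  have len: "length ?ms = length ?ns"
    using assms by (simp add: card_image)
  have "?ms ! i \<le> ?ns ! i" if i: "i < length ?ns" for i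
  proof (rule ccontr)
    assume "\<not> ?ms ! i \<le> ?ns ! i"
    then have lt: "?ns ! i < ?ms ! i" by simp
    \<comment> \<open>the first \<open>i + 1\<close> elements of \<open>B\<close> have their images among the first \<open>i\<close> elements of \<open>g ` B\<close>\<close>
    have "g ` (\<lambda>j. ?ns ! j) ` {..i} \<subseteq> (\<lambda>j. ?ms ! j) ` {..<i}"
    proof clarify
      fix j assume j: "j \<le> i"
      have "?ns ! j \<in> set ?ns" using i j by (intro nth_mem) simp
      then have jB: "?ns ! j \<in> B" using assms(1) by simp
      then have "g (?ns ! j) \<in> set ?ms" using assms(1) by simp
      then obtain l where l: "l < length ?ms" "?ms ! l = g (?ns ! j)"
        by (metis in_set_conv_nth)
      have "g (?ns ! j) \<le> ?ns ! j" using assms(3) jB by blast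
      also have "\<dots> \<le> ?ns ! i"
        using sorted_nth_mono[OF sorted_sorted_list_of_set] i j by blast
      finally have "?ms ! l < ?ms ! i" using lt l by simp
      then have "l < i"
        using sorted_nth_mono[OF sorted_sorted_list_of_set, of i l "g ` B"] l
        by (meson not_le)
      then show "g (?ns ! j) \<in> (\<lambda>j. ?ms ! j) ` {..<i}"
        using l by (metis imageI lessThan_iff)
    qed
    then have "card (g ` (\<lambda>j. ?ns ! j) ` {..i}) \<le> card ((\<lambda>j. ?ms ! j) ` {..<i})"
      by (intro card_mono) auto
    also have "\<dots> \<le> i" using card_image_le[of "{..<i}" "\<lambda>j. ?ms ! j"] by simp
    finally have le: "card (g ` (\<lambda>j. ?ns ! j) ` {..i}) \<le> i" .
    have sub: "(\<lambda>j. ?ns ! j) ` {..i} \<subseteq> B"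
    proof clarify
      fix j assume "j \<le> i"
      then have "?ns ! j \<in> set ?ns" using i by (intro nth_mem) simp
      then show "?ns ! j \<in> B" using assms(1) by simp
    qed
    have "inj_on (\<lambda>j. ?ns ! j) {..i}"
      using i by (intro inj_on_nth) auto
    then have "card ((\<lambda>j. ?ns ! j) ` {..i}) = Suc i" by (simp add: card_image)
    moreover have "card (g ` (\<lambda>j. ?ns ! j) ` {..i}) = card ((\<lambda>j. ?ns ! j) ` {..i})"
      using assms(2) sub by (intro card_image) (rule inj_on_subset)
    ultimately show False using le by simp
  qed
  then show ?thesis using len by (simp add: list_all2_conv_all_nth)
qed

text \<open>Spreading, stated for an arbitrary injective matching: the order of the elements can be forgotten,
  because the \<open>i\<close>-th smallest element of \<open>g ` B\<close> is still at most the \<open>i\<close>-th smallest element of \<open>B\<close>.\<close>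
lemma spreading_inj:
  assumes "hereditary \<M>" "spreading \<M>" "A \<in> \<M>" "finite B"
    and "inj_on g B" "g ` B \<subseteq> A" "\<And>b. b \<in> B \<Longrightarrow> g b \<le> b"
  shows "B \<in> \<M>"
proof -
  have gB: "g ` B \<in> \<M>" using assms by (auto simp: hereditary_def)
  have "list_all2 (\<le>) (sorted_list_of_set (g ` B)) (sorted_list_of_set B)"
    using assms by (intro sorted_list_of_set_image_le) auto
  moreover have "set (sorted_list_of_set (g ` B)) \<in> \<M>" using gB assms(4) by simp
  ultimately have "set (sorted_list_of_set B) \<in> \<M>"
    using assms(2) strict_sorted_list_of_set unfolding spreading_def by blast
  then show ?thesis using assms(4) by simp
qed

definition restrict_sets :: "nat set \<Rightarrow> nat set list \<Rightarrow> nat set list" where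
  "restrict_sets A Es = filter (\<lambda>E. E \<noteq> {}) (map (\<lambda>E. E \<inter> A) Es)"

lemma allowable_disjoint:
  assumes "allowable \<M> Es" "E \<in> set Es" "F \<in> set Es" "E \<noteq> F"
  shows "E \<inter> F = {}"
proof -
  obtain i j where ij: "i < length Es" "j < length Es" "E = Es ! i" "F = Es ! j"
    using assms by (auto simp: in_set_conv_nth)
  with assms(4) consider "i < j" | "j < i" by (metis linorder_neqE_nat)
  then show ?thesis using assms(1) ij by cases (auto simp: allowable_def)
qed

lemma allowable_distinct:
  assumes "allowable \<M> Es"
  shows "distinct Es"
proof -
  have "Es ! i \<noteq> Es ! j" if "i < j" "j < length Es" for i j
  proof -
    have "Es ! i \<inter> Es ! j = {}" "Es ! i \<noteq> {}"
      using assms that by (auto simp: allowable_def min_in_family_def)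
    then show ?thesis by auto
  qed
  then show ?thesis unfolding distinct_conv_nth by (metis linorder_neqE_nat)
qed

text \<open>In this form admissibility visibly passes to restrictions and implies allowability. The
  definition compares neighbours only; comparing all pairs needs that the sets are nonempty.\<close>
lemma admissible_iff_sorted_wrt:
  "admissible \<M> Es \<longleftrightarrow> min_in_family \<M> Es \<and> sorted_wrt (\<lambda>E F. \<forall>a\<in>E. \<forall>b\<in>F. a < b) Es"
proof (cases "min_in_family \<M> Es")
  case True
  then have ne: "finite (Es ! i)" "Es ! i \<noteq> {}" if "i < length Es" for i
    using that by (auto simp: min_in_family_def)
  have mono: "Max (Es ! i) < Min (Es ! j)"
    if adm: "\<forall>i. Suc i < length Es \<longrightarrow> Max (Es ! i) < Min (Es ! Suc i)"
      and "i < j" "j < length Es" for i j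
    using \<open>i < j\<close> \<open>j < length Es\<close>
  proof (induction j)
    case (Suc j)
    show ?case
    proof (cases "i = j")
      case False
      with Suc have "Max (Es ! i) < Min (Es ! j)" by simp
      also have "Min (Es ! j) \<le> Max (Es ! j)" using ne[of j] Suc.prems by simp
      also have "\<dots> < Min (Es ! Suc j)" using adm Suc.prems by simp
      finally show ?thesis .
    qed (use adm Suc.prems in simp)
  qed simp
  show ?thesis
  proof
    assume "admissible \<M> Es"
    then have adm: "\<forall>i. Suc i < length Es \<longrightarrow> Max (Es ! i) < Min (Es ! Suc i)"
      by (simp add: admissible_def)
    have "a < b" if "i < j" "j < length Es" "a \<in> Es ! i" "b \<in> Es ! j" for i j a b
    proof -
      have "a \<le> Max (Es ! i)" "Min (Es ! j) \<le> b"
        using that ne[of i] ne[of j] by simp_all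
      then show ?thesis using mono[OF adm that(1,2)] by simp
    qed
    then show "min_in_family \<M> Es \<and> sorted_wrt (\<lambda>E F. \<forall>a\<in>E. \<forall>b\<in>F. a < b) Es"
      using True unfolding sorted_wrt_iff_nth_less by blast
  next
    assume *: "min_in_family \<M> Es \<and> sorted_wrt (\<lambda>E F. \<forall>a\<in>E. \<forall>b\<in>F. a < b) Es"
    have "Max (Es ! i) < Min (Es ! Suc i)" if "Suc i < length Es" for i
    proof -
      have "\<forall>a\<in>Es ! i. \<forall>b\<in>Es ! Suc i. a < b"
        using * that unfolding sorted_wrt_iff_nth_less by blast
      then show ?thesis using that ne[of i] ne[of "Suc i"] by simp
    qed
    with True show "admissible \<M> Es" by (simp add: admissible_def)
  qed
qed (simp add: admissible_def)

lemma admissible_imp_allowable: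
  assumes "admissible \<M> Es"
  shows "allowable \<M> Es"
  using assms unfolding admissible_iff_sorted_wrt allowable_def sorted_wrt_iff_nth_less
  by blast

text \<open>Restricting the sets of an allowable sequence only moves their minima to the right, but it may
  change their order, so that spreading has to be used in the form of \<open>spreading_inj\<close>: the old
  minima are matched with the new ones set by set, not listed in increasing order.\<close>
lemma min_in_family_restrict:
  assumes "hereditary \<M>" "spreading \<M>" "allowable \<M> Es" "restrict_sets A Es \<noteq> []"
  shows "min_in_family \<M> (restrict_sets A Es)"
proof -
  have fam: "finite E" "E \<noteq> {}" "0 \<notin> E" if "E \<in> set Es" for E
    using assms(3) that by (auto simp: allowable_def min_in_family_def)
  have disj: "E = F" if "E \<in> set Es" "F \<in> set Es" "n \<in> E" "n \<in> F" for E F n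
    using allowable_disjoint[OF assms(3)] that by blast
  let ?B = "Min ` set (restrict_sets A Es)"
  have "\<forall>b\<in>?B. \<exists>E. E \<in> set Es \<and> E \<inter> A \<noteq> {} \<and> b = Min (E \<inter> A)"
    by (auto simp: restrict_sets_def)
  from bchoice[OF this] obtain h
    where h: "\<And>b. b \<in> ?B \<Longrightarrow> h b \<in> set Es \<and> h b \<inter> A \<noteq> {} \<and> b = Min (h b \<inter> A)"
    by blast
  have "?B \<in> \<M>"
  proof (rule spreading_inj[OF assms(1,2)])
    show "Min ` set Es \<in> \<M>" using assms(3) by (simp add: allowable_def min_in_family_def)
    show "(Min \<circ> h) ` ?B \<subseteq> Min ` set Es" using h by auto
    show "inj_on (Min \<circ> h) ?B"
    proof (rule inj_onI)
      fix a b assume ab: "a \<in> ?B" "b \<in> ?B" "(Min \<circ> h) a = (Min \<circ> h) b"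
      have E: "h a \<in> set Es" "h b \<in> set Es" using h ab by blast+
      have "Min (h a) \<in> h a" "Min (h b) \<in> h b" using E fam Min_in by blast+
      then have "h a = h b" using disj[OF E] ab(3) by simp
      then have "Min (h a \<inter> A) = Min (h b \<inter> A)" by simp
      then show "a = b" using h[OF ab(1)] h[OF ab(2)] by linarith
    qed
    show "(Min \<circ> h) b \<le> b" if "b \<in> ?B" for b
    proof -
      have "Min (h b) \<le> Min (h b \<inter> A)" using h[OF that] fam by (intro Min_antimono) auto
      also have "\<dots> = b" using h[OF that] by simp
      finally show ?thesis by simp
    qed
  qed simp
  then show ?thesis using assms(4) fam
    by (auto simp: min_in_family_def restrict_sets_def)
qed

lemma allowable_restrict:
  assumes "hereditary \<M>" "spreading \<M>" "allowable \<M> Es" "restrict_sets A Es \<noteq> []"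
  shows "allowable \<M> (restrict_sets A Es)"
proof -
  have "sorted_wrt (\<lambda>E F. E \<inter> F = {}) Es"
    using assms(3) by (simp add: allowable_def sorted_wrt_iff_nth_less)
  then have "sorted_wrt (\<lambda>E F. E \<inter> F = {}) (restrict_sets A Es)"
    unfolding restrict_sets_def
    by (intro sorted_wrt_filter) (auto simp: sorted_wrt_map intro: sorted_wrt_mono_rel[rotated])
  then show ?thesis
    using min_in_family_restrict[OF assms] by (simp add: allowable_def sorted_wrt_iff_nth_less)
qed

lemma admissible_restrict:
  assumes "hereditary \<M>" "spreading \<M>" "admissible \<M> Es" "restrict_sets A Es \<noteq> []"
  shows "admissible \<M> (restrict_sets A Es)"
proof -
  have "sorted_wrt (\<lambda>E F. \<forall>a\<in>E. \<forall>b\<in>F. a < b) Es"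
    using assms(3) by (simp add: admissible_iff_sorted_wrt)
  then have "sorted_wrt (\<lambda>E F. \<forall>a\<in>E. \<forall>b\<in>F. a < b) (restrict_sets A Es)"
    unfolding restrict_sets_def
    by (intro sorted_wrt_filter) (auto simp: sorted_wrt_map intro: sorted_wrt_mono_rel[rotated])
  then show ?thesis
    using min_in_family_restrict[OF assms(1,2) admissible_imp_allowable[OF assms(3)] assms(4)]
    by (simp add: admissible_iff_sorted_wrt)
qed

section \<open>The norming set\<close>

definition disjointly_supported :: "(nat \<Rightarrow> real) set \<Rightarrow> bool" where
  "disjointly_supported G \<longleftrightarrow> pairwise (\<lambda>f g. \<forall>n. f n = 0 \<or> g n = 0) G"

lemma disjointly_supportedD:
  assumes "disjointly_supported G" "f \<in> G" "g \<in> G" "f n \<noteq> 0" "g n \<noteq> 0"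
  shows "f = g"
  using assms unfolding disjointly_supported_def pairwise_def by blast

lemma sum_disjointly_supported:
  assumes "finite G" "disjointly_supported G" "f \<in> G" "f n \<noteq> 0" "w 0 = (0::real)"
  shows "(\<Sum>g\<in>G. w (g n)) = w (f n)"
proof -
  have "(\<Sum>g\<in>G. w (g n)) = (\<Sum>g\<in>{f}. w (g n))"
  proof (rule sum.mono_neutral_right)
    show "\<forall>g\<in>G - {f}. w (g n) = 0"
    proof
      fix g assume "g \<in> G - {f}"
      then have "g n = 0" using disjointly_supportedD[OF assms(2) _ assms(3) _ assms(4)] by blast
      then show "w (g n) = 0" using assms(5) by simp
    qed
  qed (use assms in auto)
  then show ?thesis by simp
qed

text \<open>Unlike \<^const>\<open>pairing\<close>, this also evaluates functionals with infinite support,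
  such as the pointwise limits of functionals of the norming set.\<close>
definition act :: "(nat \<Rightarrow> real) \<Rightarrow> (nat \<Rightarrow> real) \<Rightarrow> real" where
  "act x \<phi> = (\<Sum>n\<in>supp x. x n * \<phi> n)"

lemma act_superset:
  assumes "finite A" "supp x \<subseteq> A"
  shows "act x \<phi> = (\<Sum>n\<in>A. x n * \<phi> n)"
  unfolding act_def using assms by (intro sum.mono_neutral_left) (auto simp: supp_def)

lemma pairing_superset:
  assumes "finite A" "supp f \<subseteq> A"
  shows "pairing x f = (\<Sum>n\<in>A. x n * f n)"
  unfolding pairing_def using assms by (intro sum.mono_neutral_left) (auto simp: supp_def)

lemma pairing_eq_act:
  assumes "x \<in> c00" "finite (supp f)"
  shows "pairing x f = act x f"
  using assms act_superset[of "supp x \<union> supp f" x f] pairing_superset[of "supp x \<union> supp f" f x]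
  by (auto simp: c00_def)

lemma c00_add: "x \<in> c00 \<Longrightarrow> y \<in> c00 \<Longrightarrow> (\<lambda>n. x n + y n) \<in> c00"
  by (auto simp: c00_def supp_def intro: finite_subset[of _ "supp x \<union> supp y"])

lemma c00_scale: "x \<in> c00 \<Longrightarrow> (\<lambda>n. c * x n) \<in> c00"
  by (auto simp: c00_def supp_def intro: finite_subset[of _ "supp x"])

lemma c00_restrict: "x \<in> c00 \<Longrightarrow> (\<lambda>n. if n \<in> A then x n else 0) \<in> c00"
  by (auto simp: c00_def supp_def intro: finite_subset[of _ "supp x"])

lemma act_add:
  assumes "x \<in> c00" "y \<in> c00"
  shows "act (\<lambda>n. x n + y n) \<phi> = act x \<phi> + act y \<phi>"
proof -
  have fin: "finite (supp x \<union> supp y)" using assms by (simp add: c00_def)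
  have "supp (\<lambda>n. x n + y n) \<subseteq> supp x \<union> supp y" by (auto simp: supp_def)
  then show ?thesis
    using act_superset[OF fin, of x \<phi>] act_superset[OF fin, of y \<phi>]
      act_superset[OF fin, of "\<lambda>n. x n + y n" \<phi>]
    by (simp add: sum.distrib algebra_simps)
qed

lemma act_scale:
  assumes "x \<in> c00"
  shows "act (\<lambda>n. c * x n) \<phi> = c * act x \<phi>"
proof -
  have fin: "finite (supp x)" using assms by (simp add: c00_def)
  have "supp (\<lambda>n. c * x n) \<subseteq> supp x" by (auto simp: supp_def)
  then show ?thesis
    using act_superset[OF fin, of "\<lambda>n. c * x n" \<phi>]
    by (simp add: act_def sum_distrib_left algebra_simps)
qed

text \<open>The two constructions of the theorem differ only in the condition \<open>P\<close>. What the argument uses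
  is that \<open>P k\<close> forces the supports to be disjoint with minima in \<open>\<M> k\<close>, that it survives
  restrictions, and that \<open>P 1\<close> is allowability: functionals of the norming set that are disjointly
  but not successively supported must be summable at the cost of a factor \<open>\<theta> 1\<close>.\<close>
locale modified_mixed_tsirelson =
  fixes \<M> :: "nat \<Rightarrow> nat set set" and \<theta> :: "nat \<Rightarrow> real"
    and P :: "nat \<Rightarrow> nat set list \<Rightarrow> bool"
  assumes finite_M: "\<And>k. k \<ge> 1 \<Longrightarrow> finite_family (\<M> k)"
    and compact_M: "\<And>k. k \<ge> 1 \<Longrightarrow> compact_family (\<M> k)"
    and theta: "\<And>k. k \<ge> 1 \<Longrightarrow> 0 < \<theta> k \<and> \<theta> k < 1"
    and theta_decreasing: "\<And>k. k \<ge> 1 \<Longrightarrow> \<theta> (Suc k) \<le> \<theta> k"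
    and theta_lim: "\<theta> \<longlonglongrightarrow> 0"
    and schreier_M: "schreier \<subseteq> \<M> 1"
    and P_allowable: "\<And>k Es. k \<ge> 1 \<Longrightarrow> P k Es \<Longrightarrow> allowable (\<M> k) Es"
    and P_restrict: "\<And>k Es A. k \<ge> 1 \<Longrightarrow> P k Es \<Longrightarrow> restrict_sets A Es \<noteq> [] \<Longrightarrow>
      P k (restrict_sets A Es)"
    and P_1: "\<And>Es. allowable (\<M> 1) Es \<Longrightarrow> P 1 Es"
begin

abbreviation K :: "(nat \<Rightarrow> real) set" where "K \<equiv> norming_set P \<theta>"
abbreviation N :: "(nat \<Rightarrow> real) \<Rightarrow> real" where "N \<equiv> norm_by K"

lemma theta_le_theta_1:
  assumes "k \<ge> 1" shows "\<theta> k \<le> \<theta> 1"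
  using assms
proof (induction k rule: dec_induct)
  case (step k)
  then show ?case using theta_decreasing[of k] by simp
qed simp

lemma combine_as_set:
  assumes "k \<ge> 1" "P k (map supp fs)"
  shows "disjointly_supported (set fs)" "Min ` supp ` set fs \<in> \<M> k"
    "(\<Sum>f\<leftarrow>fs. w f) = (\<Sum>f\<in>set fs. w f)" "\<And>f. f \<in> set fs \<Longrightarrow> finite (supp f) \<and> supp f \<noteq> {}"
proof -
  have al: "allowable (\<M> k) (map supp fs)" using P_allowable assms by blast
  then have dist: "distinct (map supp fs)" by (rule allowable_distinct)
  show "(\<Sum>f\<leftarrow>fs. w f) = (\<Sum>f\<in>set fs. w f)"
    using dist by (simp add: distinct_map sum_list_distinct_conv_sum_set)
  have inj: "inj_on supp (set fs)" using dist by (simp add: distinct_map)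
  show "disjointly_supported (set fs)"
    unfolding disjointly_supported_def pairwise_def
  proof (intro ballI impI allI)
    fix f g n assume fg: "f \<in> set fs" "g \<in> set fs" "f \<noteq> g"
    then have "supp f \<noteq> supp g" using inj by (auto dest: inj_onD)
    then have "supp f \<inter> supp g = {}" using allowable_disjoint[OF al] fg by auto
    then show "f n = 0 \<or> g n = 0" by (auto simp: supp_def)
  qed
  show "Min ` supp ` set fs \<in> \<M> k" using al by (simp add: allowable_def min_in_family_def)
  show "finite (supp f) \<and> supp f \<noteq> {}" if "f \<in> set fs" for f
    using that al by (auto simp: allowable_def min_in_family_def)
qed

lemma norming_set_coeffs:
  assumes "f \<in> K"
  shows "finite (supp f)" "supp f \<noteq> {}" "f 0 = 0" "\<bar>f n\<bar> \<le> 1"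
proof -
  have "finite (supp f) \<and> supp f \<noteq> {} \<and> f 0 = 0 \<and> (\<forall>n. \<bar>f n\<bar> \<le> 1)" using assms
  proof induction
    case (combine k fs)
    note S = combine_as_set[OF combine.hyps(1,3)]
    let ?g = "\<lambda>i. \<theta> k * (\<Sum>f\<leftarrow>fs. f i)"
    have eq: "?g n = \<theta> k * (\<Sum>f\<in>set fs. f n)" for n by (simp add: S(3))
    have val: "?g n = \<theta> k * f n" if "f \<in> set fs" "f n \<noteq> 0" for f n
      using sum_disjointly_supported[OF _ S(1) that, of "\<lambda>x. x"] by (simp add: eq)
    have zero: "?g n = 0" if "\<And>f. f \<in> set fs \<Longrightarrow> f n = 0" for n
      using that sum.neutral[of "set fs" "\<lambda>f. f n"] unfolding eq by simp
    have "fs \<noteq> []" using P_allowable[OF combine.hyps(1,3)]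
      by (auto simp: allowable_def min_in_family_def)
    then obtain f where f: "f \<in> set fs" by (cases fs) auto
    then obtain n where n: "f n \<noteq> 0" using S(4) by (auto simp: supp_def)
    then have "n \<in> supp ?g" using val[OF f n] theta[OF combine.hyps(1)] by (simp add: supp_def)
    moreover have "supp ?g \<subseteq> (\<Union>f\<in>set fs. supp f)"
      using zero by (force simp: supp_def)
    then have "finite (supp ?g)" by (rule finite_subset) (use S(4) in auto)
    moreover have "?g 0 = 0" using zero combine by blast
    moreover have "\<bar>?g n\<bar> \<le> 1" for n
    proof (cases "\<exists>f\<in>set fs. f n \<noteq> 0")
      case True
      then obtain f where f: "f \<in> set fs" "f n \<noteq> 0" by blast
      have "\<bar>f n\<bar> \<le> 1" using combine f by blast
      then show ?thesis using theta[OF combine.hyps(1)]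
        by (simp add: val[OF f] abs_mult mult_le_one)
    qed (use zero[of n] in auto)
    ultimately show ?case by blast
  qed (auto simp: unit_vec_def supp_def)
  then show "finite (supp f)" "supp f \<noteq> {}" "f 0 = 0" "\<bar>f n\<bar> \<le> 1" by auto
qed

text \<open>This makes the unit vectors an unconditional basis. In the inductive step the summands that
  are killed by \<open>\<epsilon>\<close> must be dropped from the list, since supports in allowable sequences are
  nonempty; this is also why the zero functional is excluded.\<close>
lemma norming_set_solid:
  assumes "f \<in> K" "\<And>n. \<epsilon> n \<in> {-1, 0, 1}" "supp (\<lambda>n. \<epsilon> n * f n) \<noteq> {}"
  shows "(\<lambda>n. \<epsilon> n * f n) \<in> K"
  using assms(1,3)
proof induction
  case (unit_pos n)
  then have "\<epsilon> n \<noteq> 0" by (auto simp: supp_def unit_vec_def split: if_splits)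
  then have "(\<lambda>i. \<epsilon> i * unit_vec n i) = unit_vec n \<or>
      (\<lambda>i. \<epsilon> i * unit_vec n i) = (\<lambda>i. - unit_vec n i)"
    using assms(2)[of n] by (auto simp: unit_vec_def fun_eq_iff)
  then show ?case using norming_set.unit_pos[OF unit_pos.hyps] norming_set.unit_neg[OF unit_pos.hyps]
    by metis
next
  case (unit_neg n)
  then have "\<epsilon> n \<noteq> 0" by (auto simp: supp_def unit_vec_def split: if_splits)
  then have "(\<lambda>i. \<epsilon> i * - unit_vec n i) = unit_vec n \<or>
      (\<lambda>i. \<epsilon> i * - unit_vec n i) = (\<lambda>i. - unit_vec n i)"
    using assms(2)[of n] by (auto simp: unit_vec_def fun_eq_iff)
  then show ?case using norming_set.unit_pos[OF unit_neg.hyps] norming_set.unit_neg[OF unit_neg.hyps]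
    by metis
next
  case (combine k fs)
  let ?r = "\<lambda>f n. \<epsilon> n * f n"
  let ?gs = "filter (\<lambda>g. supp g \<noteq> {}) (map ?r fs)"
  have supp_r: "supp (?r f) = supp f \<inter> {n. \<epsilon> n \<noteq> 0}" for f by (auto simp: supp_def)
  have supps: "map supp ?gs = restrict_sets {n. \<epsilon> n \<noteq> 0} (map supp fs)"
    unfolding restrict_sets_def by (simp add: filter_map comp_def supp_r)
  have sums: "\<epsilon> n * (\<theta> k * (\<Sum>f\<leftarrow>fs. f n)) = \<theta> k * (\<Sum>g\<leftarrow>?gs. g n)" for n
  proof -
    have "(\<Sum>g\<leftarrow>?gs. g n) = (\<Sum>g\<leftarrow>map ?r fs. g n)"
      by (rule sum_list_map_filter) (auto simp: supp_def)
    also have "\<dots> = \<epsilon> n * (\<Sum>f\<leftarrow>fs. f n)" by (simp add: sum_list_const_mult comp_def)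
    finally show ?thesis by simp
  qed
  have "?gs \<noteq> []"
  proof
    assume Nil: "?gs = []"
    have "\<epsilon> n * (\<theta> k * (\<Sum>f\<leftarrow>fs. f n)) = 0" for n unfolding sums Nil by simp
    then show False using combine.prems unfolding supp_def by blast
  qed
  then have "map supp ?gs \<noteq> []" by (simp only: map_is_Nil_conv not_False_eq_True)
  then have "P k (map supp ?gs)"
    unfolding supps by (rule P_restrict[OF combine.hyps(1,3)])
  moreover have "g \<in> K" if "g \<in> set ?gs" for g
    using that combine.IH by auto
  ultimately have "(\<lambda>i. \<theta> k * (\<Sum>g\<leftarrow>?gs. g i)) \<in> K"
    using norming_set.combine[OF combine.hyps(1)] by blast
  then show ?case unfolding sums .
qed

text \<open>The minima of the supports form a Schreier set, and beyond that \<open>P 1\<close> only asks for disjoint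
  supports, so that any enumeration of \<open>G\<close> will do.\<close>
lemma schreier_combine:
  assumes "finite G" "G \<noteq> {}" "G \<subseteq> K" "disjointly_supported G"
    and late: "\<And>f n. f \<in> G \<Longrightarrow> f n \<noteq> 0 \<Longrightarrow> card G \<le> n"
  shows "(\<lambda>n. \<theta> 1 * (\<Sum>f\<in>G. f n)) \<in> K"
proof -
  obtain fs where fs: "set fs = G" "distinct fs" using finite_distinct_list[OF assms(1)] by blast
  have f: "finite (supp f)" "supp f \<noteq> {}" "0 \<notin> supp f" if "f \<in> G" for f
    using norming_set_coeffs[of f] assms(3) that by (auto simp: supp_def)
  have Min_ge: "card G \<le> Min (supp f)" if "f \<in> G" for f
    using f[OF that] late[OF that] by (simp add: supp_def)
  have "card (Min ` supp ` G) \<le> Min (Min ` supp ` G)"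
  proof -
    have "card (Min ` supp ` G) \<le> card G"
      using assms(1) by (metis card_image_le finite_imageI order_trans)
    moreover have "card G \<le> Min (Min ` supp ` G)"
      using assms(1,2) Min_ge by simp
    ultimately show ?thesis by simp
  qed
  moreover have "0 \<notin> Min ` supp ` G"
    using f by (auto dest!: Min_in[rotated]) (metis Min_in)
  ultimately have "Min ` supp ` G \<in> schreier" using assms(1) by (simp add: schreier_def)
  then have fam: "Min ` supp ` G \<in> \<M> 1" using schreier_M by blast
  have "allowable (\<M> 1) (map supp fs)"
    unfolding allowable_def min_in_family_def
  proof (intro conjI allI impI ballI)
    show "map supp fs \<noteq> []" using fs assms(2) by auto
    show "Min ` set (map supp fs) \<in> \<M> 1" using fam fs by simp
    fix i j assume ij: "i < j" "j < length (map supp fs)"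
    then have "fs ! i \<noteq> fs ! j" "fs ! i \<in> G" "fs ! j \<in> G"
      using fs by (auto simp: nth_eq_iff_index_eq)
    then have "supp (fs ! i) \<inter> supp (fs ! j) = {}"
      using disjointly_supportedD[OF assms(4)] by (fastforce simp: supp_def)
    then show "map supp fs ! i \<inter> map supp fs ! j = {}" using ij by simp
  qed (use f fs in auto)
  then have "P 1 (map supp fs)" by (rule P_1)
  moreover have "f \<in> K" if "f \<in> set fs" for f using that fs assms(3) by blast
  ultimately have "(\<lambda>n. \<theta> 1 * (\<Sum>f\<leftarrow>fs. f n)) \<in> K"
    using norming_set.combine[of 1 fs] by simp
  then show ?thesis using fs by (simp add: sum_list_distinct_conv_sum_set)
qed

subsection \<open>The norm\<close>

lemma norm_bdd:
  assumes "x \<in> c00" shows "bdd_above (pairing x ` K)"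
proof (rule bdd_aboveI2)
  fix f assume f: "f \<in> K"
  have "pairing x f = (\<Sum>n\<in>supp x. x n * f n)"
    using pairing_eq_act[OF assms] norming_set_coeffs(1)[OF f] by (simp add: act_def)
  also have "\<dots> \<le> (\<Sum>n\<in>supp x. \<bar>x n\<bar>)"
  proof (rule sum_mono)
    fix n
    have "x n * f n \<le> \<bar>x n\<bar> * \<bar>f n\<bar>" by (metis abs_ge_self abs_mult)
    also have "\<dots> \<le> \<bar>x n\<bar> * 1" using norming_set_coeffs(4)[OF f] by (intro mult_left_mono) auto
    finally show "x n * f n \<le> \<bar>x n\<bar>" by simp
  qed
  finally show "pairing x f \<le> (\<Sum>n\<in>supp x. \<bar>x n\<bar>)" .
qed

lemma norm_upper:
  assumes "x \<in> c00" "f \<in> K" shows "act x f \<le> N x"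
  using cSUP_upper[OF assms(2) norm_bdd[OF assms(1)]] pairing_eq_act[OF assms(1)]
    norming_set_coeffs(1)[OF assms(2)] by (simp add: norm_by_def)

lemma norm_least:
  assumes "x \<in> c00" "\<And>f. f \<in> K \<Longrightarrow> act x f \<le> B" shows "N x \<le> B"
  unfolding norm_by_def
proof (rule cSUP_least)
  show "K \<noteq> {}" using norming_set.unit_pos[of 1] by blast
  show "pairing x f \<le> B" if "f \<in> K" for f
    using assms that pairing_eq_act[OF assms(1)] norming_set_coeffs(1)[OF that] by simp
qed

lemma norm_approx:
  assumes "x \<in> c00" "B < N x" obtains f where "f \<in> K" "B < act x f"
  using norm_least[OF assms(1), of B] assms(2) by (meson not_le)

lemma coeff_le_norm:
  assumes "x \<in> c00" shows "\<bar>x n\<bar> \<le> N x" "0 \<le> N x"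
proof -
  have act_unit: "act x (unit_vec n) = x n" "act x (\<lambda>i. - unit_vec n i) = - x n" for n
  proof -
    have *: "act x \<phi> = (\<Sum>i\<in>insert n (supp x). x i * \<phi> i)" for \<phi>
      using assms by (intro act_superset) (auto simp: c00_def)
    have fin: "finite (insert n (supp x))" using assms by (simp add: c00_def)
    have "act x (unit_vec n) = (\<Sum>i\<in>insert n (supp x). if i = n then x i else 0)"
      unfolding * by (intro sum.cong) (auto simp: unit_vec_def)
    then show "act x (unit_vec n) = x n" using fin by simp
    then show "act x (\<lambda>i. - unit_vec n i) = - x n"
      by (simp add: act_def sum_negf)
  qed
  have *: "\<bar>x n\<bar> \<le> N x" if "n \<ge> 1" for n
    using norm_upper[OF assms norming_set.unit_pos[OF that, of P \<theta>]]
      norm_upper[OF assms norming_set.unit_neg[OF that, of P \<theta>]] act_unit[of n] by linarith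
  from *[of 1] show "0 \<le> N x" by linarith
  then show "\<bar>x n\<bar> \<le> N x" using *[of n] assms by (cases n) (auto simp: c00_def)
qed

text \<open>After sign changes, which make all terms nonnegative, and restriction to the sets \<open>E i\<close>, the
  functionals can be combined with factor \<open>\<theta> 1\<close>. Those that vanish have to be left out.\<close>
lemma schreier_estimate:
  assumes x: "x \<in> c00" and "finite I" and f: "\<And>i. i \<in> I \<Longrightarrow> f i \<in> K"
    and E: "disjoint_family_on E I" and late: "\<And>i n. i \<in> I \<Longrightarrow> n \<in> E i \<Longrightarrow> card I \<le> n"
  shows "\<theta> 1 * (\<Sum>i\<in>I. \<Sum>n\<in>supp x \<inter> E i. \<bar>x n * f i n\<bar>) \<le> N x"
proof -
  have fin: "finite (supp x)" using x by (simp add: c00_def)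
  define \<epsilon> where "\<epsilon> i n = (if n \<in> E i then sgn (x n * f i n) else 0)" for i n
  define g where "g i = (\<lambda>n. \<epsilon> i n * f i n)" for i
  have g_in: "g i \<in> K" if "i \<in> I" "supp (g i) \<noteq> {}" for i
    using norming_set_solid[OF f[OF that(1)], of "\<epsilon> i"] that(2)
    by (auto simp: g_def \<epsilon>_def sgn_if)
  define I' where "I' = {i \<in> I. supp (g i) \<noteq> {}}"
  have I': "finite I'" "I' \<subseteq> I" using assms(2) by (auto simp: I'_def)
  have gE: "n \<in> E i" if "g i n \<noteq> 0" for i n
    using that by (auto simp: g_def \<epsilon>_def split: if_splits)
  have eqI: "i = j" if "i \<in> I'" "j \<in> I'" "g i n \<noteq> 0" "g j n \<noteq> 0" for i j n
    using gE that I'(2) E unfolding disjoint_family_on_def by blast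
  have inj: "inj_on g I'"
  proof (rule inj_onI)
    fix i j assume ij: "i \<in> I'" "j \<in> I'" "g i = g j"
    then obtain n where "g i n \<noteq> 0" by (auto simp: I'_def supp_def)
    then show "i = j" using eqI ij by metis
  qed
  have xg: "x n * g i n = (if n \<in> E i then \<bar>x n * f i n\<bar> else 0)" for i n
    by (auto simp: g_def \<epsilon>_def sgn_if abs_if)
  have sum_g: "(\<Sum>n\<in>supp x \<inter> E i. \<bar>x n * f i n\<bar>) = (\<Sum>n\<in>supp x. x n * g i n)" for i
    unfolding xg using fin by (simp add: sum.If_cases Int_commute)
  have eq: "(\<Sum>i\<in>I. \<Sum>n\<in>supp x \<inter> E i. \<bar>x n * f i n\<bar>) = (\<Sum>i\<in>I'. \<Sum>n\<in>supp x. x n * g i n)"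
    unfolding sum_g using assms(2)
    by (intro sum.mono_neutral_right) (auto simp: I'_def supp_def)
  show ?thesis
  proof (cases "I' = {}")
    case True
    then show ?thesis using eq coeff_le_norm(2)[OF x] by simp
  next
    case False
    have "(\<lambda>n. \<theta> 1 * (\<Sum>h\<in>g ` I'. h n)) \<in> K"
    proof (rule schreier_combine)
      show "g ` I' \<subseteq> K" using g_in by (auto simp: I'_def)
      show "disjointly_supported (g ` I')"
        unfolding disjointly_supported_def pairwise_def using eqI by blast
      have "card (g ` I') \<le> card I"
        using card_image_le[OF I'(1), of g] card_mono[OF assms(2) I'(2)] by simp
      then show "card (g ` I') \<le> n" if h: "h \<in> g ` I'" "h n \<noteq> 0" for h n
      proof -
        from h(1) obtain i where "i \<in> I'" "h = g i" by blast
        with h(2) have "card I \<le> n" using gE late I'(2) by blast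
        with \<open>card (g ` I') \<le> card I\<close> show ?thesis by simp
      qed
    qed (use I' False in auto)
    from norm_upper[OF x this] show ?thesis
      unfolding eq by (simp add: sum.reindex[OF inj] act_def sum_distrib_left mult.left_commute
          sum.swap[of _ I'])
  qed
qed

lemma abs_le_norm:
  assumes x: "x \<in> c00" and f: "f \<in> K"
  shows "(\<Sum>n\<in>supp x. \<bar>x n * f n\<bar>) \<le> N x"
proof -
  have fin: "finite (supp x)" using x by (simp add: c00_def)
  define \<epsilon> where "\<epsilon> n = sgn (x n * f n)" for n
  have eq: "(\<Sum>n\<in>supp x. \<bar>x n * f n\<bar>) = act x (\<lambda>n. \<epsilon> n * f n)"
    unfolding act_def \<epsilon>_def by (intro sum.cong) (auto simp: sgn_if abs_if)
  show ?thesis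
  proof (cases "supp (\<lambda>n. \<epsilon> n * f n) = {}")
    case True
    then have "\<epsilon> n * f n = 0" for n by (auto simp: supp_def)
    then have "act x (\<lambda>n. \<epsilon> n * f n) = 0"
      unfolding act_def by (intro sum.neutral) simp
    then show ?thesis using coeff_le_norm(2)[OF x] eq by simp
  next
    case False
    then have "(\<lambda>n. \<epsilon> n * f n) \<in> K"
      by (intro norming_set_solid[OF f]) (auto simp: \<epsilon>_def sgn_if)
    then show ?thesis unfolding eq by (rule norm_upper[OF x])
  qed
qed

lemma norm_restrict:
  assumes x: "x \<in> c00"
  shows "N (\<lambda>n. if n \<in> A then x n else 0) \<le> N x"
proof (rule norm_least[OF c00_restrict[OF x]])
  fix f assume f: "f \<in> K"
  have "act (\<lambda>n. if n \<in> A then x n else 0) f = (\<Sum>n\<in>supp x. (if n \<in> A then x n else 0) * f n)"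
    using x by (intro act_superset) (auto simp: c00_def supp_def)
  also have "\<dots> \<le> (\<Sum>n\<in>supp x. \<bar>x n * f n\<bar>)" by (intro sum_mono) auto
  also have "\<dots> \<le> N x" by (rule abs_le_norm[OF x f])
  finally show "act (\<lambda>n. if n \<in> A then x n else 0) f \<le> N x" .
qed

end

section \<open>Pointwise limits of functionals of the norming set\<close>

lemma tendsto_fun_iff:
  fixes u :: "'b \<Rightarrow> 'a \<Rightarrow> 'c::topological_space"
  shows "(u \<longlongrightarrow> l) F \<longleftrightarrow> (\<forall>a. ((\<lambda>j. u j a) \<longlongrightarrow> l a) F)"
  using limitin_componentwise[of "\<lambda>_. euclidean" UNIV u l F]
  by (simp add: euclidean_product_topology)

lemma pointwise_convergent_subsequence:
  fixes u :: "nat \<Rightarrow> 'a::countable \<Rightarrow> real"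
  assumes "\<And>j a. \<bar>u j a\<bar> \<le> 1"
  obtains r l where "strict_mono r" "\<And>a. (\<lambda>j. u (r j) a) \<longlonglongrightarrow> l a"
proof -
  let ?C = "PiE UNIV (\<lambda>_::'a. {-1..1::real})"
  have "compactin (product_topology (\<lambda>_::'a. euclidean :: real topology) UNIV) ?C"
    by (simp add: compactin_PiE)
  then have "compact ?C" by (simp add: euclidean_product_topology)
  then have "seq_compact ?C" by (rule compact_imp_seq_compact)
  moreover have "u j \<in> ?C" for j using assms[of j] by (auto simp: abs_le_iff minus_le_iff)
  ultimately obtain r l where "strict_mono r" "(u \<circ> r) \<longlonglongrightarrow> l"
    unfolding seq_compact_def by blast
  then show ?thesis using that by (auto simp: tendsto_fun_iff)
qed

context modified_mixed_tsirelson
begin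

text \<open>The Schreier estimate involves only finitely many coefficients of each \<open>f i\<close> and thus passes to
  pointwise limits. As the sets \<open>E i\<close> are fixed in advance, the approximating functionals need not be
  disjointly supported.\<close>
lemma closure_schreier_estimate:
  assumes x: "x \<in> c00" and "finite I" and f: "\<And>i. i \<in> I \<Longrightarrow> f i \<in> closure K"
    and E: "disjoint_family_on E I" and late: "\<And>i n. i \<in> I \<Longrightarrow> n \<in> E i \<Longrightarrow> card I \<le> n"
  shows "\<theta> 1 * (\<Sum>i\<in>I. \<Sum>n\<in>supp x \<inter> E i. \<bar>x n * f i n\<bar>) \<le> N x"
proof -
  have "\<forall>i\<in>I. \<exists>u. (\<forall>j. u j \<in> K) \<and> u \<longlonglongrightarrow> f i" using f by (simp add: closure_sequential)
  then obtain u where u: "\<And>i j. i \<in> I \<Longrightarrow> u i j \<in> K" "\<And>i. i \<in> I \<Longrightarrow> u i \<longlonglongrightarrow> f i" by metis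
  have "\<theta> 1 * (\<Sum>i\<in>I. \<Sum>n\<in>supp x \<inter> E i. \<bar>x n * u i j n\<bar>) \<le> N x" for j
    using u(1) by (intro schreier_estimate[OF x assms(2) _ E late]) auto
  moreover have "(\<lambda>j. \<theta> 1 * (\<Sum>i\<in>I. \<Sum>n\<in>supp x \<inter> E i. \<bar>x n * u i j n\<bar>))
      \<longlonglongrightarrow> \<theta> 1 * (\<Sum>i\<in>I. \<Sum>n\<in>supp x \<inter> E i. \<bar>x n * f i n\<bar>)"
    using u(2) by (intro tendsto_intros) (simp add: tendsto_fun_iff)
  ultimately show ?thesis by (intro LIMSEQ_le_const2) blast+
qed

lemma closure_act_le_norm:
  assumes x: "x \<in> c00" and f: "f \<in> closure K"
  shows "\<bar>act x f\<bar> \<le> N x"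
proof -
  obtain u where u: "\<And>j. u j \<in> K" "u \<longlonglongrightarrow> f" using f by (auto simp: closure_sequential)
  have "\<bar>act x (u j)\<bar> \<le> N x" for j
    unfolding act_def by (rule order_trans[OF sum_abs abs_le_norm[OF x u(1)]])
  moreover have "(\<lambda>j. \<bar>act x (u j)\<bar>) \<longlonglongrightarrow> \<bar>act x f\<bar>"
    unfolding act_def using u(2) by (intro tendsto_intros) (simp add: tendsto_fun_iff)
  ultimately show ?thesis by (intro LIMSEQ_le_const2) blast+
qed

text \<open>The functionals obtained by an operation with parameter \<open>k\<close>, with the summands as a set rather
  than a list and with only the information on the supports that the passage to limits uses.\<close>
definition level :: "nat \<Rightarrow> (nat \<Rightarrow> real) set" where
  "level k = {f. \<exists>G. finite G \<and> G \<subseteq> K \<and> disjointly_supported G \<and> Min ` supp ` G \<in> \<M> k \<and>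
     f = (\<lambda>n. \<theta> k * (\<Sum>g\<in>G. g n))}"

lemma norming_set_levels:
  "K \<subseteq> {f. \<forall>a b. a \<noteq> b \<longrightarrow> f a * f b = 0} \<union> (\<Union>k\<in>{1..}. level k)"
proof
  fix f assume "f \<in> K"
  then show "f \<in> {f. \<forall>a b. a \<noteq> b \<longrightarrow> f a * f b = 0} \<union> (\<Union>k\<in>{1..}. level k)"
  proof cases
    case (combine k fs)
    note S = combine_as_set[OF combine(2,4)]
    have "f \<in> level k" unfolding level_def mem_Collect_eq
      using S(1,2) combine(1,3) by (intro exI[of _ "set fs"]) (auto simp: S(3))
    then show ?thesis using combine(2) by auto
  qed (auto simp: unit_vec_def)
qed

lemma level_coeffs:
  assumes "k \<ge> 1" "f \<in> level k" shows "\<bar>f n\<bar> \<le> \<theta> k"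
proof -
  obtain G where G: "finite G" "G \<subseteq> K" "disjointly_supported G" "f = (\<lambda>n. \<theta> k * (\<Sum>g\<in>G. g n))"
    using assms(2) by (auto simp: level_def)
  have "\<bar>\<Sum>g\<in>G. g n\<bar> \<le> 1"
  proof (cases "\<exists>g\<in>G. g n \<noteq> 0")
    case True
    then obtain g where g: "g \<in> G" "g n \<noteq> 0" by blast
    then show ?thesis
      using sum_disjointly_supported[OF G(1,3) g, of "\<lambda>t. t"] norming_set_coeffs(4) G(2) by auto
  next
    case False
    then have "(\<Sum>g\<in>G. g n) = 0" by (intro sum.neutral) auto
    then show ?thesis by simp
  qed
  then show ?thesis using theta[OF assms(1)]
    by (simp add: G(4) abs_mult mult_left_le)
qed

text \<open>Limits of functionals \<open>\<theta> k * (g\<^sub>1 + \<dots> + g\<^sub>d)\<close> have the same form, with \<open>g\<^sub>i\<close> limits of functionals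
  of the norming set, even though \<open>d\<close> may be unbounded along the sequence: after indexing the summands
  by the minima of their supports, the sets of minima subconverge to a member of the compact family
  \<open>\<M> k\<close>, which is finite, and the summands whose minima escape do not contribute to the limit.\<close>
lemma closure_level:
  assumes k: "k \<ge> 1" and \<phi>: "\<phi> \<in> closure (level k)"
  obtains H where "finite H" "H \<subseteq> closure K" "disjointly_supported H"
    "\<And>h n. h \<in> H \<Longrightarrow> h n \<noteq> 0 \<Longrightarrow> \<phi> n = \<theta> k * h n"
    "\<And>n. \<phi> n \<noteq> 0 \<Longrightarrow> \<exists>h\<in>H. h n \<noteq> 0"
proof -
  obtain \<phi>s where "\<And>j. \<phi>s j \<in> level k" and \<phi>s: "\<phi>s \<longlonglongrightarrow> \<phi>"
    using \<phi> by (auto simp: closure_sequential)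
  then have "\<forall>j. \<exists>G. finite G \<and> G \<subseteq> K \<and> disjointly_supported G \<and> Min ` supp ` G \<in> \<M> k \<and>
     \<phi>s j = (\<lambda>n. \<theta> k * (\<Sum>g\<in>G. g n))" by (simp add: level_def)
  then obtain G where G: "\<And>j. finite (G j)" "\<And>j. G j \<subseteq> K" "\<And>j. disjointly_supported (G j)"
    "\<And>j. Min ` supp ` G j \<in> \<M> k" "\<And>j. \<phi>s j = (\<lambda>n. \<theta> k * (\<Sum>g\<in>G j. g n))"
    by metis
  define A where "A j = Min ` supp ` G j" for j
  have "\<forall>j a. \<exists>f. (a \<in> A j \<longrightarrow> f \<in> G j \<and> Min (supp f) = a) \<and> (a \<notin> A j \<longrightarrow> f = (\<lambda>_. 0))"
    by (auto simp: A_def)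
  then obtain F where F: "\<And>j a. a \<in> A j \<Longrightarrow> F j a \<in> G j \<and> Min (supp (F j a)) = a"
    "\<And>j a. a \<notin> A j \<Longrightarrow> F j a = (\<lambda>_. 0)" by metis
  have F_nz: "a \<in> A j" "F j a \<in> G j" "Min (supp (F j a)) = a" "a \<le> n" if "F j a n \<noteq> 0" for j a n
  proof -
    show "a \<in> A j" using F(2)[of a j] that by (cases "a \<in> A j") simp_all
    then show *: "F j a \<in> G j" "Min (supp (F j a)) = a" using F(1) by auto
    have "finite (supp (F j a))" using norming_set_coeffs(1) * G(2) by blast
    then have "Min (supp (F j a)) \<le> n" using that by (intro Min_le) (auto simp: supp_def)
    then show "a \<le> n" using * by simp
  qed
  have F_disj: "a = b" if "F j a n \<noteq> 0" "F j b n \<noteq> 0" for j a b n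
  proof -
    have "F j a = F j b"
      using disjointly_supportedD[OF G(3) F_nz(2)[OF that(1)] F_nz(2)[OF that(2)] that] .
    then have "Min (supp (F j a)) = Min (supp (F j b))" by (rule arg_cong)
    then show ?thesis unfolding F_nz(3)[OF that(1)] F_nz(3)[OF that(2)] .
  qed
  have F_le1: "\<bar>F j a n\<bar> \<le> 1" for j a n
    using F_nz(2)[of j a n] norming_set_coeffs(4) G(2) by (cases "F j a n = 0") auto
  have sum_F: "(\<Sum>g\<in>G j. g n) = (\<Sum>a\<le>n. F j a n)" for j n
  proof (cases "\<exists>g\<in>G j. g n \<noteq> 0")
    case True
    then obtain g where g: "g \<in> G j" "g n \<noteq> 0" by blast
    have fin: "finite (supp g)" "supp g \<noteq> {}" using norming_set_coeffs g G(2) by blast+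
    let ?a = "Min (supp g)"
    have a: "?a \<in> A j" using g by (auto simp: A_def)
    have "Min (supp (F j ?a)) = ?a" "F j ?a \<in> G j" using F(1)[OF a] by auto
    moreover have "finite (supp (F j ?a))" "supp (F j ?a) \<noteq> {}"
      using norming_set_coeffs \<open>F j ?a \<in> G j\<close> G(2) by blast+
    ultimately have "?a \<in> supp (F j ?a)" "?a \<in> supp g" using Min_in fin by metis+
    then have eq: "F j ?a = g"
      using disjointly_supportedD[OF G(3) \<open>F j ?a \<in> G j\<close> g(1)] by (auto simp: supp_def)
    have "?a \<le> n" using fin g by (intro Min_le) (auto simp: supp_def)
    have "(\<Sum>a\<le>n. F j a n) = (\<Sum>a\<in>{?a}. F j a n)"
      using F_disj[of j ?a n] g(2) eq \<open>?a \<le> n\<close> by (intro sum.mono_neutral_right) auto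
    then show ?thesis using sum_disjointly_supported[OF G(1,3) g, of "\<lambda>t. t"] eq by simp
  next
    case False
    then have "F j a n = 0" for a using F_nz(2) by blast
    then show ?thesis using False by (simp add: sum.neutral)
  qed
  \<comment> \<open>one sequence recording both the summands and the sets of minima, so that a single
    subsequence works for both\<close>
  define u :: "nat \<Rightarrow> nat \<times> nat + nat \<Rightarrow> real"
    where "u j = case_sum (\<lambda>(a, n). F j a n) (\<lambda>a. of_bool (a \<in> A j))" for j
  have "\<bar>u j c\<bar> \<le> 1" for j c using F_le1 by (auto simp: u_def split: sum.split)
  then obtain r l where r: "strict_mono r" and l: "\<And>c. (\<lambda>j. u (r j) c) \<longlonglongrightarrow> l c"
    using pointwise_convergent_subsequence[of u] by blast
  define F' where "F' a n = l (Inl (a, n))" for a n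
  define A' where "A' = {a. l (Inr a) > 1/2}"
  have F': "(\<lambda>j. F (r j) a n) \<longlonglongrightarrow> F' a n" for a n
    using l[of "Inl (a, n)"] by (simp add: u_def F'_def)
  have A': "\<forall>\<^sub>F j in sequentially. a \<in> A (r j) \<longleftrightarrow> a \<in> A'" for a
  proof (cases "a \<in> A'")
    case True
    have "(\<lambda>j. of_bool (a \<in> A (r j))) \<longlonglongrightarrow> l (Inr a)" using l[of "Inr a"] by (simp add: u_def)
    from order_tendstoD(1)[OF this, of "1/2"] True show ?thesis
      unfolding A'_def by (auto elim!: eventually_mono split: if_splits simp: of_bool_def)
  next
    case False
    have "(\<lambda>j. of_bool (a \<in> A (r j))) \<longlonglongrightarrow> l (Inr a)" using l[of "Inr a"] by (simp add: u_def)
    from order_tendstoD(2)[OF this, of "3/4"] False show ?thesis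
      unfolding A'_def by (auto elim!: eventually_mono split: if_splits simp: of_bool_def)
  qed
  have "A' \<in> \<M> k"
  proof -
    have "(\<lambda>j n. n \<in> A (r j)) \<longlonglongrightarrow> (\<lambda>n. n \<in> A')"
      unfolding tendsto_fun_iff using A' by (auto intro: tendsto_eventually)
    moreover have "(\<lambda>n. n \<in> A (r j)) \<in> (\<lambda>B n. n \<in> B) ` \<M> k" for j using G(4) by (auto simp: A_def)
    moreover have "closed ((\<lambda>B n. n \<in> B) ` \<M> k)"
      using compact_M[OF k] by (simp add: compact_family_def)
    ultimately have "(\<lambda>n. n \<in> A') \<in> (\<lambda>B n. n \<in> B) ` \<M> k"
      by (intro Lim_in_closed_set[of _ "\<lambda>j n. n \<in> A (r j)" sequentially]) auto
    then obtain B where "B \<in> \<M> k" "(\<lambda>n. n \<in> A') = (\<lambda>n. n \<in> B)" by blast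
    then have "A' = B" by (auto simp: fun_eq_iff)
    with \<open>B \<in> \<M> k\<close> show ?thesis by simp
  qed
  then have "finite A'" using finite_M[OF k] by (simp add: finite_family_def)
  have F'_closure: "F' a \<in> closure K" if "a \<in> A'" for a
  proof (rule Lim_in_closed_set[OF closed_closure])
    show "\<forall>\<^sub>F j in sequentially. F (r j) a \<in> closure K"
    proof (rule eventually_mono[OF A'[of a]])
      fix j assume "a \<in> A (r j) \<longleftrightarrow> a \<in> A'"
      then have "F (r j) a \<in> K" using that F(1)[of a "r j"] G(2) by blast
      then show "F (r j) a \<in> closure K" using closure_subset by blast
    qed
    show "(\<lambda>j. F (r j) a) \<longlonglongrightarrow> F' a" using F' by (simp add: tendsto_fun_iff)
  qed simp
  have F'_zero: "F' a n = 0" if "\<forall>\<^sub>F j in sequentially. F (r j) a n = 0" for a n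
    using tendsto_eventually[OF that] F' LIMSEQ_unique by blast
  have F'_A': "a \<in> A'" if "F' a n \<noteq> 0" for a n
  proof (rule ccontr)
    assume "a \<notin> A'"
    with A'[of a] have "\<forall>\<^sub>F j in sequentially. F (r j) a n = 0"
      using F(2) by (auto elim!: eventually_mono)
    with F'_zero that show False by blast
  qed
  have F'_le: "a \<le> n" if "F' a n \<noteq> 0" for a n
  proof (rule ccontr)
    assume "\<not> a \<le> n"
    then have "F (r j) a n = 0" for j using F_nz(4) by blast
    with F'_zero that show False by simp
  qed
  have F'_disj: "a = b" if "F' a n \<noteq> 0" "F' b n \<noteq> 0" for a b n
  proof (rule ccontr)
    assume "a \<noteq> b"
    then have zero: "(\<lambda>j. F (r j) a n * F (r j) b n) = (\<lambda>_. 0)" using F_disj by force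
    have "(\<lambda>j. F (r j) a n * F (r j) b n) \<longlonglongrightarrow> F' a n * F' b n"
      by (intro tendsto_mult F')
    then have "F' a n * F' b n = 0" unfolding zero by (rule LIMSEQ_unique[OF _ tendsto_const])
    with that show False by simp
  qed
  have \<phi>_eq: "\<phi> n = \<theta> k * (\<Sum>a\<le>n. F' a n)" for n
  proof -
    have "(\<lambda>j. \<phi>s (r j) n) \<longlonglongrightarrow> \<phi> n"
      using LIMSEQ_subseq_LIMSEQ[OF _ r] \<phi>s by (force simp: tendsto_fun_iff comp_def)
    moreover have "(\<lambda>j. \<phi>s (r j) n) \<longlonglongrightarrow> \<theta> k * (\<Sum>a\<le>n. F' a n)"
      unfolding G(5) sum_F by (intro tendsto_intros F')
    ultimately show ?thesis by (rule LIMSEQ_unique)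
  qed
  show ?thesis
  proof (rule that[of "F' ` A'"])
    show "finite (F' ` A')" using \<open>finite A'\<close> by simp
    show "F' ` A' \<subseteq> closure K" using F'_closure by blast
    show "disjointly_supported (F' ` A')"
      unfolding disjointly_supported_def pairwise_def using F'_disj by blast
    show "\<phi> n = \<theta> k * h n" if h: "h \<in> F' ` A'" "h n \<noteq> 0" for h n
    proof -
      obtain a where a: "h = F' a" using h(1) by blast
      have "(\<Sum>b\<le>n. F' b n) = (\<Sum>b\<in>{a}. F' b n)"
      proof (rule sum.mono_neutral_right)
        show "{a} \<subseteq> {..n}" using F'_le h(2) a by blast
        show "\<forall>b\<in>{..n} - {a}. F' b n = 0" using F'_disj h(2) a by blast
      qed simp
      then show ?thesis by (simp add: \<phi>_eq a)
    qed
    show "\<exists>h\<in>F' ` A'. h n \<noteq> 0" if "\<phi> n \<noteq> 0" for n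
    proof -
      have "(\<Sum>a\<le>n. F' a n) \<noteq> 0" using that unfolding \<phi>_eq by simp
      then have "\<exists>a. F' a n \<noteq> 0" by (meson sum.neutral)
      then show ?thesis using F'_A' by blast
    qed
  qed
qed

text \<open>A nonzero limit cannot come from levels \<open>k\<close> tending to infinity, because the coefficients at
  level \<open>k\<close> are at most \<open>\<theta> k\<close>.\<close>
lemma closure_norming_decompose:
  assumes "\<phi> \<in> closure K"
  obtains H D where "finite H" "H \<subseteq> closure K" "disjointly_supported H" "finite D"
    "\<And>h n. h \<in> H \<Longrightarrow> h n \<noteq> 0 \<Longrightarrow> \<phi> n \<noteq> 0"
    "\<And>n. n \<notin> D \<Longrightarrow> \<phi> n \<noteq> 0 \<Longrightarrow> \<exists>h\<in>H. \<bar>\<phi> n\<bar> \<le> \<theta> 1 * \<bar>h n\<bar>"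
proof (cases "\<exists>a. \<phi> a \<noteq> 0")
  case False
  show ?thesis by (rule that[of "{}" "{}"]) (use False in \<open>auto simp: disjointly_supported_def\<close>)
next
  case True
  then obtain a where a: "\<phi> a \<noteq> 0" by blast
  \<comment> \<open>near \<open>\<phi>\<close> the coefficient at \<open>a\<close> stays large, which leaves only finitely many levels\<close>
  define U where "U = {f :: nat \<Rightarrow> real. \<bar>f a\<bar> > \<bar>\<phi> a\<bar> / 2}"
  have "open U" unfolding U_def by (intro open_Collect_less continuous_intros continuous_on_product_coordinates)
  moreover have "\<phi> \<in> U" using a by (simp add: U_def)
  ultimately have \<phi>U: "\<phi> \<in> closure (U \<inter> K)" using open_Int_closure_subset[of U K] assms by blast
  have "\<forall>\<^sub>F k in sequentially. \<theta> k < \<bar>\<phi> a\<bar> / 2"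
    by (rule order_tendstoD(2)[OF theta_lim]) (use a in simp)
  then obtain m where m: "\<And>k. k \<ge> m \<Longrightarrow> \<theta> k < \<bar>\<phi> a\<bar> / 2" by (auto simp: eventually_sequentially)
  let ?Z = "{f :: nat \<Rightarrow> real. \<forall>a b. a \<noteq> b \<longrightarrow> f a * f b = 0}"
  let ?C = "?Z \<union> (\<Union>k\<in>{1..m}. closure (level k))"
  have "U \<inter> K \<subseteq> ?C"
  proof
    fix f assume f: "f \<in> U \<inter> K"
    then consider "f \<in> ?Z" | k where "k \<ge> 1" "f \<in> level k" using norming_set_levels by blast
    then show "f \<in> ?C"
    proof cases
      case 2
      have "\<bar>\<phi> a\<bar> / 2 < \<theta> k" using level_coeffs[OF 2, of a] f by (simp add: U_def)
      then have "k \<le> m" using m[of k] by force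
      then show ?thesis using 2 closure_subset by fastforce
    qed blast
  qed
  moreover have "closed ?C"
  proof (intro closed_Un closed_UN)
    have "closed {f :: nat \<Rightarrow> real. f a * f b = 0}" for a b
      by (intro closed_Collect_eq continuous_intros continuous_on_product_coordinates)
    then have "closed {f :: nat \<Rightarrow> real. a \<noteq> b \<longrightarrow> f a * f b = 0}" for a b
      by (cases "a = b") auto
    then show "closed ?Z" by (intro closed_Collect_all)
  qed auto
  ultimately have "closure (U \<inter> K) \<subseteq> ?C" by (rule closure_minimal)
  from subsetD[OF this \<phi>U] consider "\<phi> \<in> ?Z" | k where "k \<ge> 1" "\<phi> \<in> closure (level k)"
    by auto
  then show ?thesis
  proof cases
    case 1
    then have "supp \<phi> \<subseteq> {a}" using a by (force simp: supp_def)
    then have "finite (supp \<phi>)" by (rule finite_subset) simp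
    then show ?thesis
      by (intro that[of "{}" "supp \<phi>"]) (auto simp: disjointly_supported_def supp_def)
  next
    case 2
    obtain H where H: "finite H" "H \<subseteq> closure K" "disjointly_supported H"
      "\<And>h n. h \<in> H \<Longrightarrow> h n \<noteq> 0 \<Longrightarrow> \<phi> n = \<theta> k * h n" "\<And>n. \<phi> n \<noteq> 0 \<Longrightarrow> \<exists>h\<in>H. h n \<noteq> 0"
      using closure_level[OF 2] by metis
    show ?thesis
    proof (rule that[OF H(1-3)])
      show "\<phi> n \<noteq> 0" if "h \<in> H" "h n \<noteq> 0" for h n
        using H(4)[OF that] theta[OF 2(1)] that by simp
      show "\<exists>h\<in>H. \<bar>\<phi> n\<bar> \<le> \<theta> 1 * \<bar>h n\<bar>" if nz: "\<phi> n \<noteq> 0" for n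
      proof -
        obtain h where h: "h \<in> H" "h n \<noteq> 0" using H(5)[OF nz] by blast
        have "\<bar>\<phi> n\<bar> = \<theta> k * \<bar>h n\<bar>" using H(4)[OF h] theta[OF 2(1)] by (simp add: abs_mult)
        also have "\<dots> \<le> \<theta> 1 * \<bar>h n\<bar>" by (intro mult_right_mono theta_le_theta_1 2) auto
        finally show ?thesis using h by blast
      qed
    qed auto
  qed
qed

section \<open>Tails of pointwise limits\<close>

text \<open>Replacing every member of \<open>G\<close> by its decomposition gains a factor \<open>\<theta> 1\<close> far out, and the new
  family is again finite and disjointly supported. The Schreier estimate bounds the sum over any such
  family by \<open>1 / \<theta> 1\<close> far out, however many members it has. The members obtained by \<open>s\<close> such
  replacements are disjointly but in general not successively supported, so this bound rests on
  allowability, not admissibility, at level \<open>1\<close>.\<close>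
lemma tail_estimate:
  assumes "finite G" "G \<subseteq> closure K" "disjointly_supported G"
  shows "\<exists>n0. \<forall>x\<in>c00. (\<forall>n\<in>supp x. n0 \<le> n) \<longrightarrow>
    (\<Sum>n\<in>supp x. \<bar>x n\<bar> * (\<Sum>f\<in>G. \<bar>f n\<bar>)) \<le> \<theta> 1 ^ s / \<theta> 1 * N x"
  using assms
proof (induction s arbitrary: G)
  case 0
  show ?case
  proof (intro exI[of _ "card G"] ballI impI)
    fix x assume x: "x \<in> c00" "\<forall>n\<in>supp x. card G \<le> n"
    have "\<theta> 1 * (\<Sum>f\<in>G. \<Sum>n\<in>supp x \<inter> (supp f \<inter> supp x). \<bar>x n * f n\<bar>) \<le> N x"
    proof (rule closure_schreier_estimate[OF x(1) 0(1)])
      show "disjoint_family_on (\<lambda>f. supp f \<inter> supp x) G"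
        using disjointly_supportedD[OF 0(3)] by (fastforce simp: disjoint_family_on_def supp_def)
    qed (use 0 x in auto)
    moreover have "(\<Sum>n\<in>supp x \<inter> (supp f \<inter> supp x). \<bar>x n * f n\<bar>) = (\<Sum>n\<in>supp x. \<bar>x n * f n\<bar>)" for f
      using x by (intro sum.mono_neutral_left) (auto simp: c00_def supp_def)
    moreover have "(\<Sum>n\<in>supp x. \<bar>x n\<bar> * (\<Sum>f\<in>G. \<bar>f n\<bar>)) = (\<Sum>f\<in>G. \<Sum>n\<in>supp x. \<bar>x n * f n\<bar>)"
      by (simp only: sum_distrib_left sum.swap[of _ G] abs_mult)
    ultimately show "(\<Sum>n\<in>supp x. \<bar>x n\<bar> * (\<Sum>f\<in>G. \<bar>f n\<bar>)) \<le> \<theta> 1 ^ 0 / \<theta> 1 * N x"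
      using theta[of 1] by (simp add: field_simps)
  qed
next
  case (Suc s)
  define Q where "Q f H D \<longleftrightarrow> finite H \<and> H \<subseteq> closure K \<and> disjointly_supported H \<and> finite D \<and>
      (\<forall>h\<in>H. \<forall>n. h n \<noteq> 0 \<longrightarrow> f n \<noteq> 0) \<and>
      (\<forall>n. n \<notin> D \<longrightarrow> f n \<noteq> 0 \<longrightarrow> (\<exists>h\<in>H. \<bar>f n\<bar> \<le> \<theta> 1 * \<bar>h n\<bar>))"
    for f :: "nat \<Rightarrow> real" and H and D :: "nat set"
  have "\<forall>f\<in>G. \<exists>H D. Q f H D"
  proof
    fix f assume "f \<in> G"
    then have "f \<in> closure K" using Suc.prems by blast
    then show "\<exists>H D. Q f H D"
      by (rule closure_norming_decompose) (unfold Q_def, blast)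
  qed
  then obtain H D where Q: "\<And>f. f \<in> G \<Longrightarrow> Q f (H f) (D f)" by metis
  have H: "\<And>f. f \<in> G \<Longrightarrow> finite (H f)" "\<And>f. f \<in> G \<Longrightarrow> H f \<subseteq> closure K"
    "\<And>f. f \<in> G \<Longrightarrow> disjointly_supported (H f)" "\<And>f. f \<in> G \<Longrightarrow> finite (D f)"
    "\<And>f h n. f \<in> G \<Longrightarrow> h \<in> H f \<Longrightarrow> h n \<noteq> 0 \<Longrightarrow> f n \<noteq> 0"
    "\<And>f n. f \<in> G \<Longrightarrow> n \<notin> D f \<Longrightarrow> f n \<noteq> 0 \<Longrightarrow> \<exists>h\<in>H f. \<bar>f n\<bar> \<le> \<theta> 1 * \<bar>h n\<bar>"
    using Q unfolding Q_def by blast+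
  define G' where "G' = (\<Union>f\<in>G. H f)"
  have G': "finite G'" "G' \<subseteq> closure K" using H Suc.prems by (auto simp: G'_def)
  have "disjointly_supported G'"
    unfolding disjointly_supported_def pairwise_def
  proof (intro ballI impI allI)
    fix g h n assume gh: "g \<in> G'" "h \<in> G'" "g \<noteq> h"
    then obtain f1 f2 where f: "f1 \<in> G" "f2 \<in> G" "g \<in> H f1" "h \<in> H f2" by (auto simp: G'_def)
    show "g n = 0 \<or> h n = 0"
    proof (rule ccontr)
      assume *: "\<not> ?thesis"
      then have "f1 n \<noteq> 0" "f2 n \<noteq> 0" using H(5) f by blast+
      then have "f1 = f2" using disjointly_supportedD[OF Suc.prems(3)] f by blast
      then show False using disjointly_supportedD[OF H(3)] f gh * by blast
    qed
  qed
  from Suc.IH[OF G' this] obtain n0 where n0: "\<And>x. x \<in> c00 \<Longrightarrow> \<forall>n\<in>supp x. n0 \<le> n \<Longrightarrow>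
    (\<Sum>n\<in>supp x. \<bar>x n\<bar> * (\<Sum>f\<in>G'. \<bar>f n\<bar>)) \<le> \<theta> 1 ^ s / \<theta> 1 * N x" by blast
  have "finite (\<Union>f\<in>G. D f)" using H Suc.prems by auto
  then obtain n1 where n1: "\<And>n f. f \<in> G \<Longrightarrow> n \<in> D f \<Longrightarrow> n < n1"
    unfolding finite_nat_set_iff_bounded by blast
  have dom: "(\<Sum>f\<in>G. \<bar>f n\<bar>) \<le> \<theta> 1 * (\<Sum>g\<in>G'. \<bar>g n\<bar>)" if "n1 \<le> n" for n
  proof (cases "\<exists>f\<in>G. f n \<noteq> 0")
    case True
    then obtain f where f: "f \<in> G" "f n \<noteq> 0" by blast
    have "n \<notin> D f" using n1[OF f(1)] that by force
    then obtain h where h: "h \<in> H f" "\<bar>f n\<bar> \<le> \<theta> 1 * \<bar>h n\<bar>" using H(6)[OF f(1) _ f(2)] by blast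
    have "(\<Sum>f\<in>G. \<bar>f n\<bar>) = \<bar>f n\<bar>"
      using sum_disjointly_supported[OF Suc.prems(1,3) f, of abs] by simp
    also have "\<bar>h n\<bar> \<le> (\<Sum>g\<in>G'. \<bar>g n\<bar>)"
      using h f G'(1) by (intro member_le_sum) (auto simp: G'_def)
    then have "\<theta> 1 * \<bar>h n\<bar> \<le> \<theta> 1 * (\<Sum>g\<in>G'. \<bar>g n\<bar>)"
      using theta[of 1] by (intro mult_left_mono) auto
    with h(2) have "\<bar>f n\<bar> \<le> \<theta> 1 * (\<Sum>g\<in>G'. \<bar>g n\<bar>)" by linarith
    finally show ?thesis .
  next
    case False
    then have "(\<Sum>f\<in>G. \<bar>f n\<bar>) = 0" by (intro sum.neutral) simp
    then show ?thesis using theta[of 1] by (simp add: sum_nonneg)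
  qed
  show ?case
  proof (intro exI[of _ "max n0 n1"] ballI impI)
    fix x assume x: "x \<in> c00" "\<forall>n\<in>supp x. max n0 n1 \<le> n"
    have "(\<Sum>n\<in>supp x. \<bar>x n\<bar> * (\<Sum>f\<in>G. \<bar>f n\<bar>))
        \<le> (\<Sum>n\<in>supp x. \<bar>x n\<bar> * (\<theta> 1 * (\<Sum>g\<in>G'. \<bar>g n\<bar>)))"
      using x dom by (intro sum_mono mult_left_mono) auto
    also have "\<dots> = \<theta> 1 * (\<Sum>n\<in>supp x. \<bar>x n\<bar> * (\<Sum>g\<in>G'. \<bar>g n\<bar>))"
      by (simp add: sum_distrib_left mult.left_commute)
    also have "\<dots> \<le> \<theta> 1 * (\<theta> 1 ^ s / \<theta> 1 * N x)"
      using x n0 theta[of 1] by (intro mult_left_mono) auto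
    finally show "(\<Sum>n\<in>supp x. \<bar>x n\<bar> * (\<Sum>f\<in>G. \<bar>f n\<bar>)) \<le> \<theta> 1 ^ Suc s / \<theta> 1 * N x"
      by (simp only: power_Suc times_divide_eq_right times_divide_eq_left mult.assoc)
  qed
qed

corollary closure_norming_tail:
  assumes "\<phi> \<in> closure K" "0 < \<epsilon>"
  obtains n0 where "\<And>x. x \<in> c00 \<Longrightarrow> (\<And>n. n \<in> supp x \<Longrightarrow> n0 \<le> n) \<Longrightarrow> \<bar>act x \<phi>\<bar> \<le> \<epsilon> * N x"
proof -
  have "\<theta> 1 < 1" "0 < \<theta> 1" using theta[of 1] by auto
  then obtain s where "\<theta> 1 ^ s < \<epsilon> * \<theta> 1"
    using real_arch_pow_inv[of "\<epsilon> * \<theta> 1" "\<theta> 1"] assms(2) by auto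
  then have s: "\<theta> 1 ^ s / \<theta> 1 \<le> \<epsilon>" using \<open>0 < \<theta> 1\<close> by (simp add: field_simps)
  obtain n0 where n0: "\<And>x. x \<in> c00 \<Longrightarrow> \<forall>n\<in>supp x. n0 \<le> n \<Longrightarrow>
      (\<Sum>n\<in>supp x. \<bar>x n\<bar> * (\<Sum>f\<in>{\<phi>}. \<bar>f n\<bar>)) \<le> \<theta> 1 ^ s / \<theta> 1 * N x"
    using tail_estimate[of "{\<phi>}" s] assms(1) by (auto simp: disjointly_supported_def)
  show ?thesis
  proof (rule that[of n0])
    fix x assume x: "x \<in> c00" "\<And>n. n \<in> supp x \<Longrightarrow> n0 \<le> n"
    have "\<bar>act x \<phi>\<bar> \<le> (\<Sum>n\<in>supp x. \<bar>x n * \<phi> n\<bar>)" unfolding act_def by (rule sum_abs)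
    also have "\<dots> \<le> \<theta> 1 ^ s / \<theta> 1 * N x" using n0[OF x(1)] x(2) by (simp add: abs_mult)
    also have "\<dots> \<le> \<epsilon> * N x" using s coeff_le_norm(2)[OF x(1)] by (intro mult_right_mono)
    finally show "\<bar>act x \<phi>\<bar> \<le> \<epsilon> * N x" .
  qed
qed

end

section \<open>A sup-limsup principle of Simons\<close>

text \<open>Here \<open>h\<close> runs through the partial sums of \<open>\<Sum> 2\<^bsup>-(i+1)\<^esup> f i\<close>. The part between the steps \<open>n\<close> and \<open>j\<close>
  has mass \<open>2\<^bsup>-n\<^esup> - 2\<^bsup>-j\<^esup>\<close>; with the missing mass put at \<open>c\<close> and rescaled by \<open>2\<^bsup>n\<^esup>\<close>, it becomes a convex
  combination of points of \<open>C n\<close>.\<close>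
lemma convex_dyadic_tail:
  fixes f :: "nat \<Rightarrow> 'x::real_vector"
  assumes convex: "\<And>n. convex (C n)" and dec: "\<And>n. C (Suc n) \<subseteq> C n"
    and f: "\<And>n. f n \<in> C n" and h: "\<And>n. h (Suc n) = h n + (1/2) ^ Suc n *\<^sub>R f n"
    and "n \<le> j" "c \<in> C n"
  shows "2 ^ n *\<^sub>R (h j - h n) + (2 ^ n * (1/2) ^ j) *\<^sub>R c \<in> C n"
  using \<open>n \<le> j\<close> \<open>c \<in> C n\<close>
proof (induction j arbitrary: c rule: dec_induct)
  case base
  then show ?case by (simp flip: power_mult_distrib)
next
  case (step j)
  have "C j \<subseteq> C n"
    using lift_Suc_antimono_le[of C n j] dec step.hyps by blast
  then have "f j \<in> C n" using f by blast
  then have "(1/2) *\<^sub>R f j + (1/2) *\<^sub>R c \<in> C n"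
    using convexD[OF convex] step.prems by simp
  from step.IH[OF this] show ?case
    by (simp add: h algebra_simps)
qed

text \<open>A boundary detects what a decreasing sequence of convex sets has in common. One forms
  \<open>z = \<Sum> 2\<^bsup>-(i+1)\<^esup> f i\<close> with \<open>f i \<in> C i\<close> chosen greedily, so that moving the whole mass left after step \<open>n\<close>
  to \<open>f n\<close> almost minimises the norm, and takes a functional \<open>b\<close> of the boundary that attains its norm
  at \<open>z\<close>. By the choice of the \<open>f n\<close>, the partial sums \<open>h n\<close> leave a gap \<open>norm z - norm (h n)\<close> almost
  as large as \<open>2\<^bsup>-n\<^esup> * norm z\<close>, hence \<open>b\<close> is almost \<open>norm z\<close> on the tail \<open>2\<^bsup>n\<^esup> (z - h n)\<close>, which is a limit
  of points of \<open>C n\<close>. This replaces an integral representation of functionals on a space of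
  continuous functions together with dominated convergence.\<close>
theorem simons_sup_limsup:
  fixes C :: "nat \<Rightarrow> 'x::banach set" and B :: "('x \<Rightarrow>\<^sub>L real) set"
  assumes ball: "\<And>b. b \<in> B \<Longrightarrow> norm b \<le> 1" and attained: "\<And>z. \<exists>b\<in>B. b z = norm z"
    and convex: "\<And>n. convex (C n)" and ne: "\<And>n. C n \<noteq> {}" and dec: "\<And>n. C (Suc n) \<subseteq> C n"
    and le1: "\<And>c. c \<in> C 0 \<Longrightarrow> norm c \<le> 1" and ge: "\<And>c. c \<in> C 0 \<Longrightarrow> \<sigma> \<le> norm c"
    and "\<tau> < \<sigma>"
  obtains b where "b \<in> B" "\<And>n. \<exists>c\<in>C n. \<tau> \<le> blinfun_apply b c"
proof -
  \<comment> \<open>the choices below lose at most \<open>2 * \<delta>\<close> in total, half of the distance of \<open>\<tau>\<close> and \<open>\<sigma>\<close>\<close>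
  define \<delta> where "\<delta> = (\<sigma> - \<tau>) / 4"
  have \<delta>: "\<delta> > 0" using \<open>\<tau> < \<sigma>\<close> by (simp add: \<delta>_def)
  have C0: "C n \<subseteq> C 0" for n using lift_Suc_antimono_le[of C 0 n] dec by blast
  have "\<exists>f\<in>C n. \<forall>g\<in>C n.
      norm (h + (1/2) ^ n *\<^sub>R f) \<le> norm (h + (1/2) ^ n *\<^sub>R g) + \<delta> * (1/4) ^ n" for n h
  proof -
    let ?S = "(\<lambda>f. norm (h + (1/2) ^ n *\<^sub>R f)) ` C n"
    have bdd: "bdd_below ?S" by (rule bdd_belowI[of _ 0]) auto
    have S: "?S \<noteq> {}" using ne by simp
    have "Inf ?S < Inf ?S + \<delta> * (1/4) ^ n" using \<delta> by simp
    from cInf_lessD[OF S this] obtain f where f: "f \<in> C n" "norm (h + (1/2) ^ n *\<^sub>R f) < Inf ?S + \<delta> * (1/4) ^ n"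
      by auto
    have "Inf ?S \<le> norm (h + (1/2) ^ n *\<^sub>R g)" if "g \<in> C n" for g
      using that bdd by (intro cInf_lower) auto
    with f show ?thesis by (intro bexI[of _ f]) force+
  qed
  then obtain F where F: "\<And>n h. F n h \<in> C n"
    "\<And>n h g. g \<in> C n \<Longrightarrow>
      norm (h + (1/2) ^ n *\<^sub>R F n h) \<le> norm (h + (1/2) ^ n *\<^sub>R g) + \<delta> * (1/4) ^ n"
    by metis
  define h where "h = rec_nat 0 (\<lambda>n h. h + (1/2) ^ Suc n *\<^sub>R F n h)"
  define f where "f n = F n (h n)" for n
  have h0: "h 0 = 0" and hS: "h (Suc n) = h n + (1/2) ^ Suc n *\<^sub>R f n" for n
    by (simp_all add: h_def f_def)
  have f: "f n \<in> C n" for n using F by (simp add: f_def)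
  have f1: "norm (f n) \<le> 1" for n using le1 C0 f by blast
  note tail = convex_dyadic_tail[of C f h, OF convex dec f hS]
  have "summable (\<lambda>n. norm (h (Suc n) - h n))"
  proof (rule summable_comparison_test')
    show "summable (\<lambda>n. (1/2::real) ^ n)" by (rule summable_geometric) simp
    show "norm (norm (h (Suc n) - h n)) \<le> (1/2) ^ n" for n
    proof -
      have "norm (h (Suc n) - h n) = (1/2) ^ Suc n * norm (f n)" by (simp add: hS)
      also have "\<dots> \<le> (1/2) ^ Suc n * 1" using f1 by (intro mult_left_mono) auto
      also have "\<dots> \<le> (1/2) ^ n" by simp
      finally show ?thesis by simp
    qed
  qed
  then have "summable (\<lambda>n. h (Suc n) - h n)" by (rule summable_norm_cancel)
  then have "convergent h" by (simp add: telescope_summable' summable_iff_convergent sum_lessThan_telescope h0)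
  then obtain z where z: "h \<longlonglongrightarrow> z" by (auto simp: convergent_def)
  have half0: "(\<lambda>j. (1/2::real) ^ j) \<longlonglongrightarrow> 0" by (intro LIMSEQ_power_zero) simp
  have small: "(\<lambda>j. (1/2::real) ^ j *\<^sub>R f n) \<longlonglongrightarrow> 0" for n
    using tendsto_scaleR[OF half0 tendsto_const, of "f n"] by simp
  \<comment> \<open>the near-minimality of \<open>f n\<close> is tested against the rescaled tails of \<open>h\<close>\<close>
  have step: "norm (h n + (1/2) ^ n *\<^sub>R f n) \<le> norm z + \<delta> * (1/4) ^ n" for n
  proof -
    have "norm (h n + (1/2) ^ n *\<^sub>R f n) \<le> norm (h j + (1/2) ^ j *\<^sub>R f n) + \<delta> * (1/4) ^ n"
      if "n \<le> j" for j
    proof -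
      have eq: "h n + (1/2) ^ n *\<^sub>R (2 ^ n *\<^sub>R (h j - h n) + (2 ^ n * (1/2) ^ j) *\<^sub>R f n)
        = h j + (1/2) ^ j *\<^sub>R f n"
        by (simp add: scaleR_add_right flip: power_mult_distrib mult.assoc)
      from F(2)[OF tail[OF that f], of "h n"] show ?thesis
        unfolding eq by (simp add: f_def)
    qed
    moreover have "(\<lambda>j. norm (h j + (1/2) ^ j *\<^sub>R f n) + \<delta> * (1/4) ^ n)
        \<longlonglongrightarrow> norm (z + 0) + \<delta> * (1/4) ^ n"
      by (intro tendsto_intros z small)
    ultimately show ?thesis
      by (intro LIMSEQ_le_const) auto
  qed
  have \<sigma>z: "\<sigma> \<le> norm z"
  proof -
    have "\<sigma> \<le> norm (h j + (1/2) ^ j *\<^sub>R f 0)" for j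
      using ge tail[of 0 j "f 0"] f by (simp add: h0)
    moreover have "(\<lambda>j. norm (h j + (1/2) ^ j *\<^sub>R f 0)) \<longlonglongrightarrow> norm (z + 0)"
      by (intro tendsto_intros z small)
    ultimately show ?thesis by (intro LIMSEQ_le_const) auto
  qed
  have gap: "norm z - 2 * \<delta> + 2 * \<delta> * (1/2) ^ n \<le> 2 ^ n * (norm z - norm (h n))" for n
  proof (induction n)
    case 0
    then show ?case by (simp add: h0)
  next
    case (Suc n)
    have "2 *\<^sub>R h (Suc n) = (h n + (1/2) ^ n *\<^sub>R f n) + h n"
      by (simp add: hS scaleR_add_right scaleR_2)
    then have "2 * norm (h (Suc n)) \<le> norm (h n + (1/2) ^ n *\<^sub>R f n) + norm (h n)"
      by (metis norm_scaleR norm_triangle_ineq abs_numeral)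
    then have "2 * norm (h (Suc n)) \<le> norm z + \<delta> * (1/4) ^ n + norm (h n)"
      using step[of n] by linarith
    then have "2 ^ n * (2 * norm (h (Suc n))) \<le> 2 ^ n * (norm z + \<delta> * (1/4) ^ n + norm (h n))"
      by (intro mult_left_mono) auto
    moreover have "(2::real) ^ n * (1/4) ^ n = (1/2) ^ n"
      by (simp flip: power_mult_distrib)
    then have "2 ^ n * (norm z + \<delta> * (1/4) ^ n + norm (h n))
        = 2 ^ n * norm z + \<delta> * (1/2) ^ n + 2 ^ n * norm (h n)"
      by (simp add: distrib_left mult.left_commute)
    ultimately have
      "2 ^ n * (2 * norm (h (Suc n))) \<le> 2 ^ n * norm z + \<delta> * (1/2) ^ n + 2 ^ n * norm (h n)"
      by linarith
    then show ?case using Suc.IH by (simp add: algebra_simps)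
  qed
  obtain b where b: "b \<in> B" "blinfun_apply b z = norm z" using attained by blast
  have b1: "blinfun_apply b x \<le> norm x" for x
    using norm_blinfun[of b x] ball[OF b(1)]
    by (smt (verit) mult_left_le_one_le norm_ge_zero real_norm_def)
  have "\<exists>c\<in>C n. \<tau> \<le> blinfun_apply b c" for n
  proof (rule ccontr)
    assume *: "\<not> ?thesis"
    have "2 ^ n * blinfun_apply b (h j - h n) + 2 ^ n * blinfun_apply b ((1/2) ^ j *\<^sub>R f n) \<le> \<tau>"
      if "n \<le> j" for j
      using * tail[OF that f]
      by (force simp: blinfun.add_right blinfun.scaleR_right mult.assoc)
    moreover have "(\<lambda>j. 2 ^ n * blinfun_apply b (h j - h n)
        + 2 ^ n * blinfun_apply b ((1/2) ^ j *\<^sub>R f n))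
        \<longlonglongrightarrow> 2 ^ n * blinfun_apply b (z - h n) + 2 ^ n * blinfun_apply b 0"
      by (intro tendsto_intros z small)
    ultimately have "2 ^ n * blinfun_apply b (z - h n) + 2 ^ n * blinfun_apply b 0 \<le> \<tau>"
      by (intro LIMSEQ_le_const2) auto
    then have "2 ^ n * (norm z - blinfun_apply b (h n)) \<le> \<tau>"
      using b by (simp add: blinfun.diff_right)
    moreover have "2 ^ n * (norm z - norm (h n)) \<le> 2 ^ n * (norm z - blinfun_apply b (h n))"
      using b1 by (intro mult_left_mono) auto
    moreover have "0 \<le> 2 * \<delta> * (1/2) ^ n" using \<delta> by simp
    ultimately have "norm z - 2 * \<delta> \<le> \<tau>" using gap[of n] by linarith
    then show False using \<sigma>z \<open>\<tau> < \<sigma>\<close> by (simp add: \<delta>_def field_simps)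
  qed
  with b(1) show ?thesis by (rule that)
qed

section \<open>Bounded functionals on the completion\<close>

text \<open>Lipschitz maps into a complete space extend to the closure, and linearity passes to limits.\<close>
lemma bounded_linear_extension_dense:
  fixes T :: "'x::real_normed_vector \<Rightarrow> real"
  assumes S: "subspace S" "closure S = UNIV"
    and add: "\<And>x y. x \<in> S \<Longrightarrow> y \<in> S \<Longrightarrow> T (x + y) = T x + T y"
    and scale: "\<And>c x. x \<in> S \<Longrightarrow> T (c *\<^sub>R x) = c * T x"
    and bound: "\<And>x. x \<in> S \<Longrightarrow> \<bar>T x\<bar> \<le> B * norm x" and "0 \<le> B"
  obtains b :: "'x \<Rightarrow>\<^sub>L real" where "\<And>x. x \<in> S \<Longrightarrow> b x = T x"
proof -
  have "B-lipschitz_on S T"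
  proof (rule lipschitz_onI[OF _ \<open>0 \<le> B\<close>])
    fix x y assume xy: "x \<in> S" "y \<in> S"
    then have "T (x + (-1) *\<^sub>R y) = T x + T ((-1) *\<^sub>R y)"
      by (intro add subspace_scale[OF S(1)])
    also have "T ((-1) *\<^sub>R y) = - T y" using scale[OF xy(2), of "-1"] by simp
    finally have "T (x - y) = T x - T y" by simp
    moreover have "\<bar>T (x - y)\<bar> \<le> B * norm (x - y)"
      using xy by (intro bound subspace_diff[OF S(1)])
    ultimately show "dist (T x) (T y) \<le> B * dist x y" by (simp add: dist_norm)
  qed
  then obtain g where g: "B-lipschitz_on UNIV g" "\<And>x. x \<in> S \<Longrightarrow> g x = T x"
    using lipschitz_extend_closure[of B S T] S(2) by metis
  have cont: "isCont g x" for x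
    using lipschitz_on_continuous_on[OF g(1)] by (simp add: continuous_on_eq_continuous_at)
  have approx: "\<exists>u. (\<forall>n. u n \<in> S) \<and> u \<longlonglongrightarrow> x" for x
    using closure_sequential[of x S] S(2) by auto
  have "bounded_linear g"
  proof (rule bounded_linear_intro[of _ B])
    fix x y
    obtain u v where u: "\<And>n. u n \<in> S" "u \<longlonglongrightarrow> x" and v: "\<And>n. v n \<in> S" "v \<longlonglongrightarrow> y"
      using approx[of x] approx[of y] by blast
    have "(\<lambda>n. g (u n + v n)) \<longlonglongrightarrow> g (x + y)"
      by (rule isCont_tendsto_compose[OF cont tendsto_add[OF u(2) v(2)]])
    moreover have "g (u n + v n) = g (u n) + g (v n)" for n
      using u(1) v(1) g(2) add subspace_add[OF S(1)] by simp
    moreover have "(\<lambda>n. g (u n) + g (v n)) \<longlonglongrightarrow> g x + g y"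
      by (intro tendsto_add isCont_tendsto_compose[OF cont] u v)
    ultimately show "g (x + y) = g x + g y" using LIMSEQ_unique by force
  next
    fix c x
    obtain u where u: "\<And>n. u n \<in> S" "u \<longlonglongrightarrow> x" using approx[of x] by blast
    have "(\<lambda>n. g (c *\<^sub>R u n)) \<longlonglongrightarrow> g (c *\<^sub>R x)"
      by (rule isCont_tendsto_compose[OF cont tendsto_scaleR[OF tendsto_const u(2)]])
    moreover have "g (c *\<^sub>R u n) = c * g (u n)" for n
      using u(1) g(2) scale subspace_scale[OF S(1)] by simp
    moreover have "(\<lambda>n. c * g (u n)) \<longlonglongrightarrow> c * g x"
      by (intro tendsto_mult tendsto_const isCont_tendsto_compose[OF cont] u)
    ultimately show "g (c *\<^sub>R x) = c *\<^sub>R g x" using LIMSEQ_unique by force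
  next
    fix x
    have "g 0 = 0" using g(2)[of 0] scale[of 0 0] subspace_0[OF S(1)] by simp
    then show "norm (g x) \<le> norm x * B"
      using lipschitz_onD[OF g(1), of x 0] by (simp add: dist_norm mult.commute)
  qed
  then have "blinfun_apply (Blinfun g) = g" by (rule bounded_linear_Blinfun_apply)
  with g(2) show ?thesis by (intro that[of "Blinfun g"]) simp
qed

lemma norm_blinfun_le_dense:
  fixes b :: "'x::real_normed_vector \<Rightarrow>\<^sub>L real"
  assumes "closure S = UNIV" "\<And>x. x \<in> S \<Longrightarrow> \<bar>b x\<bar> \<le> B * norm x" "0 \<le> B"
  shows "norm b \<le> B"
proof (rule norm_blinfun_bound[OF assms(3)])
  have "closed {x. \<bar>b x\<bar> \<le> B * norm x}"
    by (intro closed_Collect_le continuous_intros)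
  then have "closure S \<subseteq> {x. \<bar>b x\<bar> \<le> B * norm x}"
    using assms(2) by (intro closure_minimal) auto
  then show "norm (b x) \<le> B * norm x" for x using assms(1) by auto
qed

lemma unit_vec_c00: "n \<ge> 1 \<Longrightarrow> unit_vec n \<in> c00"
  by (auto simp: c00_def unit_vec_def supp_def)

lemma act_unit_vec: "x \<in> c00 \<Longrightarrow> act x (unit_vec n) = x n"
  by (auto simp: act_def unit_vec_def c00_def supp_def if_distrib sum.delta cong: if_cong)

lemma restrict_to_finite_c00:
  "finite A \<Longrightarrow> 0 \<notin> A \<Longrightarrow> (\<lambda>n. if n \<in> A then a n else 0) \<in> c00"
  by (auto simp: c00_def supp_def)

lemma act_restrict:
  "finite A \<Longrightarrow> act (\<lambda>n. if n \<in> A then a n else 0) f = (\<Sum>n\<in>A. a n * f n)"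
  by (subst act_superset[of A]) (auto simp: supp_def)

locale tsirelson_completion = modified_mixed_tsirelson +
  fixes J :: "(nat \<Rightarrow> real) \<Rightarrow> 'x::banach"
  assumes completion: "is_completion N J"
begin

lemma J_add: "x \<in> c00 \<Longrightarrow> y \<in> c00 \<Longrightarrow> J (\<lambda>n. x n + y n) = J x + J y"
  and J_scale: "x \<in> c00 \<Longrightarrow> J (\<lambda>n. c * x n) = c *\<^sub>R J x"
  and norm_J: "x \<in> c00 \<Longrightarrow> norm (J x) = N x"
  and J_dense: "closure (J ` c00) = UNIV"
  using completion by (auto simp: is_completion_def)

lemma c00_diff: "x \<in> c00 \<Longrightarrow> y \<in> c00 \<Longrightarrow> (\<lambda>n. x n - y n) \<in> c00"
  using c00_add[of x "\<lambda>n. - 1 * y n"] c00_scale[of y "-1"] by simp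

lemma J_diff:
  assumes "x \<in> c00" "y \<in> c00" shows "J (\<lambda>n. x n - y n) = J x - J y"
  using J_add[OF assms(1) c00_scale[OF assms(2)], of "-1"] J_scale[OF assms(2), of "-1"] by simp

lemma act_diff:
  assumes "x \<in> c00" "y \<in> c00" shows "act (\<lambda>n. x n - y n) f = act x f - act y f"
  using act_add[OF assms(1) c00_scale[OF assms(2)], of "-1"] act_scale[OF assms(2), of "-1"] by simp

lemma J_zero: "J (\<lambda>_. 0) = 0"
  using J_scale[of "\<lambda>_. 0" 0] by (simp add: c00_def supp_def)

lemma J_inj: "inj_on J c00"
proof (rule inj_onI)
  fix x y assume xy: "x \<in> c00" "y \<in> c00" "J x = J y"
  then have "N (\<lambda>n. x n - y n) = 0" using norm_J[OF c00_diff] J_diff by (metis norm_zero diff_self)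
  then have "x n - y n = 0" for n
    using coeff_le_norm(1)[OF c00_diff[OF xy(1,2)], of n] by simp
  then show "x = y" by (simp add: fun_eq_iff)
qed

lemma J_subspace: "subspace (J ` c00)"
proof (rule subspaceI)
  show "0 \<in> J ` c00" using J_zero by (auto simp: c00_def supp_def intro!: image_eqI[of _ J "\<lambda>_. 0"])
  show "u + v \<in> J ` c00" if "u \<in> J ` c00" "v \<in> J ` c00" for u v
    using that by (auto simp flip: J_add intro!: imageI c00_add)
  show "c *\<^sub>R u \<in> J ` c00" if "u \<in> J ` c00" for c u
    using that by (auto simp flip: J_scale intro!: imageI c00_scale)
qed

lemma functional_of_coeffs:
  assumes "\<And>x. x \<in> c00 \<Longrightarrow> \<bar>act x \<phi>\<bar> \<le> N x"
  obtains b :: "'x \<Rightarrow>\<^sub>L real" where "\<And>x. x \<in> c00 \<Longrightarrow> b (J x) = act x \<phi>"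
proof -
  define T where "T z = act (inv_into c00 J z) \<phi>" for z
  have T: "T (J x) = act x \<phi>" if "x \<in> c00" for x
    using inv_into_f_f[OF J_inj that] by (simp add: T_def)
  obtain b :: "'x \<Rightarrow>\<^sub>L real" where b: "\<And>z. z \<in> J ` c00 \<Longrightarrow> b z = T z"
  proof (rule bounded_linear_extension_dense[OF J_subspace J_dense, of T 1])
    show "T (u + v) = T u + T v" if "u \<in> J ` c00" "v \<in> J ` c00" for u v
      using that by (auto simp: T act_add c00_add simp flip: J_add)
    show "T (c *\<^sub>R u) = c * T u" if "u \<in> J ` c00" for c u
      using that by (auto simp: T act_scale c00_scale simp flip: J_scale)
    show "\<bar>T u\<bar> \<le> 1 * norm u" if "u \<in> J ` c00" for u
      using that assms by (auto simp: T norm_J)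
  qed auto
  show ?thesis by (rule that[of b]) (simp add: b T)
qed

lemma norm_functional_le:
  fixes b :: "'x \<Rightarrow>\<^sub>L real"
  assumes "\<And>x. x \<in> c00 \<Longrightarrow> \<bar>b (J x)\<bar> \<le> B * N x" "0 \<le> B"
  shows "norm b \<le> B"
  using assms by (intro norm_blinfun_le_dense[OF J_dense]) (auto simp: norm_J)

text \<open>A boundary in the sense of James: pointwise limits of functionals of the norming set, extended
  to the completion. They have norm at most \<open>1\<close>, and by compactness they attain every norm.\<close>
definition boundary :: "('x \<Rightarrow>\<^sub>L real) set" where
  "boundary = {b. \<exists>\<phi>\<in>closure K. \<forall>x\<in>c00. blinfun_apply b (J x) = act x \<phi>}"

lemma boundary_norm: "b \<in> boundary \<Longrightarrow> norm b \<le> 1"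
  by (auto simp: boundary_def closure_act_le_norm intro!: norm_functional_le)

text \<open>Approximate \<open>z\<close> by finitely supported vectors \<open>x j\<close> and take \<open>f j \<in> K\<close> almost norming at \<open>x j\<close>; any
  pointwise limit \<open>\<phi>\<close> of a subsequence norms \<open>z\<close>. The limit is tested on a fixed \<open>x m\<close>, because pointwise
  convergence controls only finitely many coefficients.\<close>
lemma boundary_attained: "\<exists>b\<in>boundary. blinfun_apply b z = norm z"
proof -
  have "z \<in> closure (J ` c00)" using J_dense by simp
  then obtain v where v: "\<And>j. v j \<in> J ` c00" "v \<longlonglongrightarrow> z" by (auto simp: closure_sequential)
  then have "\<forall>j. \<exists>x. x \<in> c00 \<and> v j = J x" by blast
  then obtain x where x: "\<And>j. x j \<in> c00" "\<And>j. v j = J (x j)" by metis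
  have "\<exists>f\<in>K. norm (v j) - inverse (real (Suc j)) < act (x j) f" for j
    using norm_approx[OF x(1), of "norm (v j) - inverse (real (Suc j))" j]
      norm_J[OF x(1)] x(2) by fastforce
  then obtain f where f: "\<And>j. f j \<in> K" "\<And>j. norm (v j) - inverse (real (Suc j)) < act (x j) (f j)"
    by metis
  obtain r \<phi> where r: "strict_mono r" and \<phi>: "\<And>a. (\<lambda>j. f (r j) a) \<longlonglongrightarrow> \<phi> a"
    using pointwise_convergent_subsequence[of f] norming_set_coeffs(4)[OF f(1)] by metis
  have \<phi>_closure: "\<phi> \<in> closure K"
    unfolding closure_sequential using f(1) \<phi>
    by (intro exI[of _ "\<lambda>j. f (r j)"]) (auto simp: tendsto_fun_iff)
  then obtain b :: "'x \<Rightarrow>\<^sub>L real" where b: "\<And>x. x \<in> c00 \<Longrightarrow> b (J x) = act x \<phi>"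
    using functional_of_coeffs[of \<phi>] closure_act_le_norm by metis
  then have "b \<in> boundary" using \<phi>_closure by (auto simp: boundary_def)
  have vr: "(\<lambda>j. v (r j)) \<longlonglongrightarrow> z" using LIMSEQ_subseq_LIMSEQ[OF v(2) r] by (simp add: comp_def)
  have ge: "norm z - norm (v m - z) \<le> blinfun_apply b (v m)" for m
  proof -
    have "norm (v (r j)) - inverse (real (Suc (r j))) - norm (v m - v (r j)) \<le> act (x m) (f (r j))" for j
    proof -
      have "act (x (r j)) (f (r j)) - act (x m) (f (r j)) \<le> N (\<lambda>n. x (r j) n - x m n)"
        using norm_upper[OF c00_diff f(1)] x(1) by (simp add: act_diff)
      also have "\<dots> = norm (v (r j) - v m)"
        using norm_J[OF c00_diff[OF x(1) x(1)], of "r j" m] J_diff[OF x(1) x(1), of "r j" m] x(2)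
        by simp
      also have "\<dots> = norm (v m - v (r j))" by (rule norm_minus_commute)
      finally show ?thesis using f(2)[of "r j"] by linarith
    qed
    moreover have "(\<lambda>j. norm (v (r j)) - inverse (real (Suc (r j))) - norm (v m - v (r j)))
        \<longlonglongrightarrow> norm z - 0 - norm (v m - z)"
    proof (intro tendsto_intros vr)
      show "(\<lambda>j. inverse (real (Suc (r j)))) \<longlonglongrightarrow> 0"
        using LIMSEQ_subseq_LIMSEQ[OF LIMSEQ_inverse_real_of_nat r] by (simp add: comp_def)
    qed
    moreover have "(\<lambda>j. act (x m) (f (r j))) \<longlonglongrightarrow> act (x m) \<phi>"
      unfolding act_def by (intro tendsto_intros \<phi>)
    ultimately have "norm z - 0 - norm (v m - z) \<le> act (x m) \<phi>"
      by (intro LIMSEQ_le) blast+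
    then show ?thesis using b[OF x(1)] x(2) by simp
  qed
  have "(\<lambda>m. norm z - norm (v m - z)) \<longlonglongrightarrow> norm z - norm (z - z)"
    by (intro tendsto_intros v)
  moreover have "(\<lambda>m. blinfun_apply b (v m)) \<longlonglongrightarrow> blinfun_apply b z"
    by (intro tendsto_intros v)
  ultimately have "norm z - norm (z - z) \<le> blinfun_apply b z"
    using ge by (intro LIMSEQ_le) blast+
  moreover have "blinfun_apply b z \<le> norm z"
    using norm_blinfun[of b z] boundary_norm[OF \<open>b \<in> boundary\<close>]
    by (smt (verit) mult_left_le_one_le norm_ge_zero real_norm_def)
  ultimately show ?thesis using \<open>b \<in> boundary\<close> by (intro bexI[of _ b]) auto
qed

section \<open>The basis is shrinking\<close>

text \<open>Otherwise \<open>f\<close> is at least \<open>\<epsilon>\<close> on vectors of norm at most \<open>1\<close> supported arbitrarily far out. For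
  each \<open>m\<close> these form a convex set \<open>C m\<close>, so the principle of Simons gives a functional of the boundary
  that is bounded below on vectors arbitrarily far out, against the tail estimate.\<close>
lemma shrinking:
  fixes f :: "'x \<Rightarrow>\<^sub>L real"
  assumes "0 < \<epsilon>"
  obtains n0 where "\<And>x. x \<in> c00 \<Longrightarrow> (\<And>n. n \<in> supp x \<Longrightarrow> n0 \<le> n) \<Longrightarrow> \<bar>f (J x)\<bar> \<le> \<epsilon> * N x"
proof (rule ccontr)
  assume "\<not> thesis"
  with that have far: "\<exists>x\<in>c00. (\<forall>n\<in>supp x. m \<le> n) \<and> \<bar>f (J x)\<bar> > \<epsilon> * N x" for m
    by (meson not_le)
  define C where "C m = J ` {x \<in> c00. (\<forall>n\<in>supp x. m \<le> n) \<and> N x \<le> 1 \<and> \<epsilon> \<le> f (J x)}" for m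
  have C_ne: "C m \<noteq> {}" for m
  proof -
    obtain x where x: "x \<in> c00" "\<forall>n\<in>supp x. m \<le> n" "\<bar>f (J x)\<bar> > \<epsilon> * N x" using far by blast
    have "N x \<noteq> 0"
    proof
      assume "N x = 0"
      then have "J x = 0" using norm_J[OF x(1)] by simp
      then show False using x(3) \<open>N x = 0\<close> by (simp add: blinfun.zero_right)
    qed
    then have pos: "0 < N x" using coeff_le_norm(2)[OF x(1)] by simp
    let ?c = "sgn (f (J x)) / N x"
    let ?y = "\<lambda>n. ?c * x n"
    have "f (J x) \<noteq> 0" using x(3) pos assms by (smt (verit) mult_pos_pos)
    then have y: "?y \<in> c00" "J ?y = ?c *\<^sub>R J x" "N ?y = 1"
      using J_scale[OF x(1), of ?c] c00_scale[OF x(1), of ?c] norm_J[OF x(1)]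
        norm_J[OF c00_scale[OF x(1), of ?c]] pos
      by (auto simp: abs_mult sgn_if)
    have "f (J ?y) = \<bar>f (J x)\<bar> / N x"
      unfolding y(2) by (simp add: blinfun.scaleR_right sgn_if abs_if)
    moreover have "\<epsilon> \<le> \<bar>f (J x)\<bar> / N x" using x(3) pos by (simp add: pos_le_divide_eq)
    ultimately have "\<epsilon> \<le> f (J ?y)" by linarith
    moreover have "\<forall>n\<in>supp ?y. m \<le> n" using x(2) by (auto simp: supp_def)
    ultimately have "J ?y \<in> C m" using y(1,3) unfolding C_def by (intro imageI) simp
    then show ?thesis by blast
  qed
  have C_convex: "convex (C m)" for m
  proof (rule convexI)
    fix u v s t assume uv: "u \<in> C m" "v \<in> C m" and st: "0 \<le> s" "0 \<le> t" "s + t = (1::real)"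
    obtain x y where x: "u = J x" "x \<in> c00" "\<forall>n\<in>supp x. m \<le> n" "N x \<le> 1" "\<epsilon> \<le> f (J x)"
      and y: "v = J y" "y \<in> c00" "\<forall>n\<in>supp y. m \<le> n" "N y \<le> 1" "\<epsilon> \<le> f (J y)"
      using uv unfolding C_def by blast
    let ?w = "\<lambda>n. s * x n + t * y n"
    have w: "?w \<in> c00" "J ?w = s *\<^sub>R J x + t *\<^sub>R J y"
      using x(2) y(2) by (auto simp: J_add J_scale c00_add c00_scale)
    have "N ?w \<le> s * N x + t * N y"
      using norm_triangle_ineq[of "s *\<^sub>R J x" "t *\<^sub>R J y"] norm_J[OF w(1)] w(2)
        norm_J[OF x(2)] norm_J[OF y(2)] st by simp
    also have "\<dots> \<le> s * 1 + t * 1" using st x y by (intro add_mono mult_left_mono) auto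
    finally have "N ?w \<le> 1" using st by simp
    moreover have "\<epsilon> \<le> f (J ?w)"
    proof -
      have "\<epsilon> = s * \<epsilon> + t * \<epsilon>" using st by (simp flip: distrib_right)
      also have "\<dots> \<le> s * f (J x) + t * f (J y)"
        using st x y by (intro add_mono mult_left_mono) auto
      finally show ?thesis unfolding w(2) by (simp add: blinfun.add_right blinfun.scaleR_right)
    qed
    moreover have "\<forall>n\<in>supp ?w. m \<le> n" using x(3) y(3) by (force simp: supp_def)
    ultimately have "J ?w \<in> C m" using w(1) unfolding C_def by blast
    then show "s *\<^sub>R u + t *\<^sub>R v \<in> C m" using w(2) x(1) y(1) by simp
  qed
  have C_dec: "C (Suc m) \<subseteq> C m" for m unfolding C_def by force
  have C_le1: "norm c \<le> 1" if "c \<in> C 0" for c using that by (auto simp: C_def norm_J)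
  have C_f: "\<epsilon> \<le> norm f * norm c" if "c \<in> C 0" for c
  proof -
    have "\<epsilon> \<le> f c" using that by (auto simp: C_def)
    also have "\<dots> \<le> norm f * norm c" using norm_blinfun[of f c] by simp
    finally show ?thesis .
  qed
  obtain c0 where "c0 \<in> C 0" using C_ne by blast
  have "norm f \<noteq> 0" using C_f[OF \<open>c0 \<in> C 0\<close>] assms by auto
  then have "norm f > 0" by simp
  then have C_ge: "\<epsilon> / norm f \<le> norm c" if "c \<in> C 0" for c
    using C_f[OF that] by (simp add: field_simps)
  have "0 < \<epsilon> / norm f" using \<open>norm f > 0\<close> assms by simp
  from dense[OF this] obtain \<tau> where \<tau>: "0 < \<tau>" "\<tau> < \<epsilon> / norm f" by blast
  obtain b where b: "b \<in> boundary" "\<And>n. \<exists>c\<in>C n. \<tau> \<le> blinfun_apply b c"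
    using simons_sup_limsup[where B = boundary and C = C and \<sigma> = "\<epsilon> / norm f" and \<tau> = \<tau>,
        OF boundary_norm boundary_attained C_convex C_ne C_dec C_le1 C_ge \<tau>(2)]
    by blast
  obtain \<phi> where \<phi>: "\<phi> \<in> closure K" "\<And>x. x \<in> c00 \<Longrightarrow> blinfun_apply b (J x) = act x \<phi>"
    using b(1) by (auto simp: boundary_def)
  obtain n0 where n0: "\<And>x. x \<in> c00 \<Longrightarrow> (\<And>n. n \<in> supp x \<Longrightarrow> n0 \<le> n) \<Longrightarrow> \<bar>act x \<phi>\<bar> \<le> \<tau> / 2 * N x"
    using closure_norming_tail[OF \<phi>(1), of "\<tau> / 2"] \<tau>(1) by auto
  obtain x where x: "x \<in> c00" "\<forall>n\<in>supp x. n0 \<le> n" "N x \<le> 1" "\<tau> \<le> blinfun_apply b (J x)"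
    using b(2)[of n0] unfolding C_def by blast
  have "\<tau> \<le> \<tau> / 2 * N x" using n0[OF x(1)] x(2,4) \<phi>(2)[OF x(1)] by fastforce
  also have "\<dots> \<le> \<tau> / 2 * 1" using x(3) \<tau>(1) by (intro mult_left_mono) auto
  finally show False using \<tau>(1) by simp
qed

section \<open>The basis is boundedly complete\<close>

text \<open>If the series is not Cauchy, it has disjoint blocks of norm at least \<open>\<epsilon>\<close>. Choosing \<open>d\<close> of them beyond
  \<open>d\<close>, the Schreier estimate bounds the partial sum containing them below by \<open>\<theta> 1 * d * \<epsilon> / 2\<close>,
  which exceeds \<open>C\<close> once \<open>d\<close> is large.\<close>
lemma boundedly_complete:
  fixes a :: "nat \<Rightarrow> real"
  defines "\<sigma> \<equiv> \<lambda>n i. if i \<in> {1..n} then a i else 0"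
  assumes bound: "\<And>n. N (\<sigma> n) \<le> C"
  shows "Cauchy (\<lambda>n. J (\<sigma> n))"
proof (rule ccontr)
  have \<sigma>_c00: "\<sigma> n \<in> c00" for n unfolding \<sigma>_def by (intro restrict_to_finite_c00) auto
  assume "\<not> ?thesis"
  then obtain \<epsilon> where \<epsilon>: "0 < \<epsilon>" "\<And>M. \<exists>p\<ge>M. \<exists>q>p. \<epsilon> \<le> dist (J (\<sigma> p)) (J (\<sigma> q))"
    unfolding Cauchy_altdef by (meson not_le)
  then obtain p q where pq: "\<And>M. M \<le> p M" "\<And>M. p M < q M"
    "\<And>M. \<epsilon> \<le> dist (J (\<sigma> (p M))) (J (\<sigma> (q M)))" by metis
  define d where "d = Suc (nat \<lceil>2 * C / (\<theta> 1 * \<epsilon>)\<rceil>)"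
  \<comment> \<open>block \<open>i\<close> lies between \<open>M i\<close> and \<open>M (Suc i)\<close>, and the first one lies beyond \<open>d\<close>\<close>
  define M where "M i = (q ^^ i) d" for i
  have M_Suc: "M (Suc i) = q (M i)" for i by (simp add: M_def)
  have M_mono: "M i \<le> M j" if "i \<le> j" for i j
    using that
  proof (induction j rule: dec_induct)
    case (step j)
    then show ?case using pq(1)[of "M j"] pq(2)[of "M j"] by (simp add: M_Suc)
  qed simp
  define E where "E i = {p (M i)<..q (M i)}" for i
  have E_between: "M i < n" "n \<le> M (Suc i)" if "n \<in> E i" for i n
    using that pq(1)[of "M i"] by (auto simp: E_def M_Suc)
  let ?blk = "\<lambda>i n. if n \<in> E i then a n else 0"
  have blk_c00: "?blk i \<in> c00" for i by (rule restrict_to_finite_c00) (auto simp: E_def)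
  have "\<exists>f\<in>K. \<epsilon> / 2 < act (?blk i) f" for i
  proof -
    have "?blk i = (\<lambda>n. \<sigma> (q (M i)) n - \<sigma> (p (M i)) n)"
      using pq(2)[of "M i"] by (auto simp: \<sigma>_def E_def fun_eq_iff)
    then have "N (?blk i) = dist (J (\<sigma> (p (M i)))) (J (\<sigma> (q (M i))))"
      using norm_J[OF blk_c00[of i]] J_diff[OF \<sigma>_c00 \<sigma>_c00] by (simp add: dist_norm norm_minus_commute)
    then have "\<epsilon> / 2 < N (?blk i)" using pq(3)[of "M i"] \<epsilon>(1) by simp
    then show ?thesis using norm_approx[OF blk_c00] by metis
  qed
  then obtain f where f: "\<And>i. f i \<in> K" "\<And>i. \<epsilon> / 2 < act (?blk i) (f i)" by metis
  let ?x = "\<sigma> (M d)"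
  have "\<theta> 1 * (\<Sum>i\<in>{..<d}. \<Sum>n\<in>supp ?x \<inter> E i. \<bar>?x n * f i n\<bar>) \<le> N ?x"
  proof (rule schreier_estimate[OF \<sigma>_c00 _ f(1)])
    show "disjoint_family_on E {..<d}"
      unfolding disjoint_family_on_def
    proof (intro ballI impI)
      have "E i \<inter> E j = {}" if "i < j" for i j
      proof -
        have "M (Suc i) \<le> M j" using that by (intro M_mono) simp
        then show ?thesis using E_between by fastforce
      qed
      then show "E i \<inter> E j = {}" if "i \<noteq> j" for i j
        using that by (metis inf_commute linorder_neqE_nat)
    qed
    show "card {..<d} \<le> n" if "n \<in> E i" for i n
      using E_between(1)[OF that] M_mono[of 0 i] by (simp add: M_def)
  qed simp
  moreover have "\<epsilon> / 2 \<le> (\<Sum>n\<in>supp ?x \<inter> E i. \<bar>?x n * f i n\<bar>)" if "i < d" for i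
  proof -
    have x_eq: "?x n = a n" if "n \<in> E i" for n
      using E_between[OF that] M_mono[of "Suc i" d] \<open>i < d\<close> by (auto simp: \<sigma>_def)
    have "act (?blk i) (f i) = (\<Sum>n\<in>E i. a n * f i n)" by (rule act_restrict) (simp add: E_def)
    also have "\<dots> = (\<Sum>n\<in>E i. ?x n * f i n)" using x_eq by simp
    also have "\<dots> = (\<Sum>n\<in>supp ?x \<inter> E i. ?x n * f i n)"
      by (intro sum.mono_neutral_right) (auto simp: E_def supp_def)
    also have "\<dots> \<le> (\<Sum>n\<in>supp ?x \<inter> E i. \<bar>?x n * f i n\<bar>)" by (intro sum_mono) simp
    finally show ?thesis using f(2)[of i] by simp
  qed
  then have "(\<Sum>i\<in>{..<d}. \<epsilon> / 2) \<le> (\<Sum>i\<in>{..<d}. \<Sum>n\<in>supp ?x \<inter> E i. \<bar>?x n * f i n\<bar>)"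
    by (intro sum_mono) simp
  then have "\<theta> 1 * (real d * (\<epsilon> / 2)) \<le> \<theta> 1 * (\<Sum>i\<in>{..<d}. \<Sum>n\<in>supp ?x \<inter> E i. \<bar>?x n * f i n\<bar>)"
    using theta[of 1] by (intro mult_left_mono) auto
  ultimately have "\<theta> 1 * (real d * (\<epsilon> / 2)) \<le> C" using bound[of "M d"] by linarith
  moreover have "2 * C / (\<theta> 1 * \<epsilon>) < real d"
    unfolding d_def by linarith
  then have "C < \<theta> 1 * (real d * (\<epsilon> / 2))" using theta[of 1] \<epsilon>(1) by (simp add: field_simps)
  ultimately show False by simp
qed

section \<open>Reflexivity\<close>

lemma J_finite_sum:
  assumes "finite A" "0 \<notin> A"
  shows "J (\<lambda>n. if n \<in> A then a n else 0) = (\<Sum>n\<in>A. a n *\<^sub>R J (unit_vec n))"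
  using assms
proof (induction A rule: finite_induct)
  case (insert m A)
  have "(\<lambda>n. if n \<in> insert m A then a n else 0)
      = (\<lambda>n. a m * unit_vec m n + (if n \<in> A then a n else 0))"
    using insert.hyps by (auto simp: unit_vec_def fun_eq_iff)
  then have "J (\<lambda>n. if n \<in> insert m A then a n else 0)
      = a m *\<^sub>R J (unit_vec m) + J (\<lambda>n. if n \<in> A then a n else 0)"
    using insert by (simp add: J_add J_scale c00_scale unit_vec_c00 restrict_to_finite_c00)
  then show ?case using insert by simp
qed (simp add: J_zero)

text \<open>A functional \<open>\<Phi>\<close> on the dual determines coefficients \<open>a n = \<Phi> (es n)\<close> by its values on the
  coordinate functionals \<open>es n\<close>. The partial sums with these coefficients are bounded by \<open>norm \<Phi>\<close>, so
  they converge to some \<open>z\<close> by bounded completeness; as the basis is shrinking, every \<open>f\<close> is the norm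
  limit of its truncations, on which \<open>\<Phi>\<close> is evaluation at the partial sums.\<close>
theorem reflexive_completion: "reflexive TYPE('x)"
  unfolding reflexive_def surj_def
proof
  fix \<Phi> :: "('x \<Rightarrow>\<^sub>L real) \<Rightarrow>\<^sub>L real"
  have "\<exists>b :: 'x \<Rightarrow>\<^sub>L real. \<forall>x\<in>c00. b (J x) = x n" for n
    using functional_of_coeffs[of "unit_vec n"] act_unit_vec coeff_le_norm(1) by metis
  then obtain es :: "nat \<Rightarrow> 'x \<Rightarrow>\<^sub>L real" where es: "\<And>n x. x \<in> c00 \<Longrightarrow> es n (J x) = x n" by metis
  define a where "a n = \<Phi> (es n)" for n
  define \<sigma> where "\<sigma> n i = (if i \<in> {1..n} then a i else 0)" for n i
  have \<sigma>_c00: "\<sigma> n \<in> c00" for n unfolding \<sigma>_def by (intro restrict_to_finite_c00) auto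
  have "N (\<sigma> n) \<le> norm \<Phi>" for n
  proof (rule norm_least[OF \<sigma>_c00])
    fix f assume f: "f \<in> K"
    let ?g = "\<Sum>i\<in>{1..n}. f i *\<^sub>R es i"
    have "norm ?g \<le> 1"
    proof (rule norm_functional_le)
      fix x assume x: "x \<in> c00"
      have "\<bar>blinfun_apply ?g (J x)\<bar> = \<bar>\<Sum>i\<in>{1..n}. x i * f i\<bar>"
        by (simp add: blinfun.sum_left blinfun.scaleR_left es[OF x] mult.commute)
      also have "\<dots> \<le> (\<Sum>i\<in>{1..n}. \<bar>x i * f i\<bar>)" by (rule sum_abs)
      also have "\<dots> = (\<Sum>i\<in>{1..n} \<inter> supp x. \<bar>x i * f i\<bar>)"
        by (intro sum.mono_neutral_right) (auto simp: supp_def)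
      also have "\<dots> \<le> (\<Sum>i\<in>supp x. \<bar>x i * f i\<bar>)"
        using x by (intro sum_mono2) (auto simp: c00_def)
      also have "\<dots> \<le> 1 * N x" using abs_le_norm[OF x f] by simp
      finally show "\<bar>blinfun_apply ?g (J x)\<bar> \<le> 1 * N x" .
    qed simp
    have "act (\<sigma> n) f = \<Phi> ?g"
      unfolding \<sigma>_def by (subst act_restrict)
        (auto simp: a_def blinfun.sum_right blinfun.scaleR_right mult.commute)
    also have "\<dots> \<le> norm \<Phi> * norm ?g" using norm_blinfun[of \<Phi> ?g] by simp
    also have "\<dots> \<le> norm \<Phi> * 1" using \<open>norm ?g \<le> 1\<close> by (intro mult_left_mono) auto
    finally show "act (\<sigma> n) f \<le> norm \<Phi>" by simp
  qed
  then have "Cauchy (\<lambda>n. J (\<sigma> n))" unfolding \<sigma>_def by (rule boundedly_complete)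
  then obtain z where z: "(\<lambda>n. J (\<sigma> n)) \<longlonglongrightarrow> z"
    using Cauchy_convergent convergent_def by blast
  have "\<Phi> f = f z" for f
  proof -
    have "(\<lambda>n. f (J (\<sigma> n))) \<longlonglongrightarrow> \<Phi> f"
    proof (rule LIMSEQ_I)
      fix e :: real assume "0 < e"
      define \<epsilon> where "\<epsilon> = e / 2 / (norm \<Phi> + 1)"
      have pos: "0 < norm \<Phi> + 1" by (simp add: add_nonneg_pos)
      then have "0 < \<epsilon>" using \<open>0 < e\<close> by (simp add: \<epsilon>_def)
      moreover have "\<epsilon> * (norm \<Phi> + 1) = e / 2"
        unfolding \<epsilon>_def using pos by (intro nonzero_eq_divide_eq[THEN iffD1]) auto
      ultimately have \<epsilon>: "0 < \<epsilon>" "\<epsilon> * (norm \<Phi> + 1) < e" using \<open>0 < e\<close> by auto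
      obtain n0 where n0: "\<And>x. x \<in> c00 \<Longrightarrow> (\<And>n. n \<in> supp x \<Longrightarrow> n0 \<le> n) \<Longrightarrow> \<bar>f (J x)\<bar> \<le> \<epsilon> * N x"
        using shrinking[OF \<epsilon>(1), of f] by blast
      have "norm (f (J (\<sigma> n)) - \<Phi> f) < e" if n: "n0 \<le> n" for n
      proof -
        let ?g = "f - (\<Sum>i\<in>{1..n}. f (J (unit_vec i)) *\<^sub>R es i)"
        have "norm ?g \<le> \<epsilon>"
        proof (rule norm_functional_le)
          fix x assume x: "x \<in> c00"
          let ?h = "\<lambda>i. if i \<in> {1..n} then x i else 0"
          let ?t = "\<lambda>i. if i \<in> {n<..} then x i else 0"
          have h: "?h \<in> c00" and t: "?t \<in> c00" using c00_restrict[OF x] by blast+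
          have "?t = (\<lambda>i. x i - ?h i)" using x by (auto simp: c00_def fun_eq_iff not_less Suc_le_eq)
          then have "J ?t = J x - J ?h"
            using J_diff[OF x h] by simp
          moreover have "f (J ?h) = (\<Sum>i\<in>{1..n}. x i * f (J (unit_vec i)))"
            by (subst J_finite_sum) (auto simp: blinfun.sum_right blinfun.scaleR_right)
          moreover have "blinfun_apply ?g (J x) = f (J x) - (\<Sum>i\<in>{1..n}. x i * f (J (unit_vec i)))"
            by (simp add: blinfun.diff_left blinfun.sum_left blinfun.scaleR_left es[OF x] mult.commute)
          ultimately have "blinfun_apply ?g (J x) = f (J ?t)" by (simp only: blinfun.diff_right)
          also have "\<bar>f (J ?t)\<bar> \<le> \<epsilon> * N ?t"
            using n by (intro n0[OF t]) (auto simp: supp_def split: if_splits)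
          also have "\<dots> \<le> \<epsilon> * N x" using \<epsilon>(1) by (intro mult_left_mono norm_restrict[OF x]) simp
          finally show "\<bar>blinfun_apply ?g (J x)\<bar> \<le> \<epsilon> * N x" .
        qed (use \<epsilon> in simp)
        have "f (J (\<sigma> n)) = (\<Sum>i\<in>{1..n}. a i * f (J (unit_vec i)))"
          unfolding \<sigma>_def by (subst J_finite_sum) (auto simp: blinfun.sum_right blinfun.scaleR_right)
        then have "\<Phi> f - f (J (\<sigma> n)) = \<Phi> ?g"
          by (simp add: blinfun.diff_right blinfun.sum_right blinfun.scaleR_right a_def mult.commute)
        then have "norm (f (J (\<sigma> n)) - \<Phi> f) = norm (\<Phi> ?g)" by (metis norm_minus_commute)
        also have "\<dots> \<le> norm \<Phi> * norm ?g" by (rule norm_blinfun)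
        also have "\<dots> \<le> norm \<Phi> * \<epsilon>" using \<open>norm ?g \<le> \<epsilon>\<close> by (intro mult_left_mono) auto
        also have "\<dots> \<le> \<epsilon> * (norm \<Phi> + 1)" using \<epsilon>(1) by (simp add: algebra_simps)
        finally show ?thesis using \<epsilon>(2) by simp
      qed
      then show "\<exists>n0. \<forall>n\<ge>n0. norm (f (J (\<sigma> n)) - \<Phi> f) < e" by blast
    qed
    moreover have "(\<lambda>n. f (J (\<sigma> n))) \<longlonglongrightarrow> f z" by (intro tendsto_intros z)
    ultimately show ?thesis by (rule LIMSEQ_unique)
  qed
  then show "\<exists>x. \<Phi> = canonical_embedding x"
    by (intro exI[of _ z] blinfun_eqI) simp
qed

end

theorem theorem1p27:
  fixes \<M> :: "nat \<Rightarrow> nat set set" and \<theta> :: "nat \<Rightarrow> real"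
    and J :: "(nat \<Rightarrow> real) \<Rightarrow> 'x::banach"
  assumes "\<And>k. k \<ge> 1 \<Longrightarrow> finite_family (\<M> k)"
    and "\<And>k. k \<ge> 1 \<Longrightarrow> compact_family (\<M> k)"
    and "\<And>k. k \<ge> 1 \<Longrightarrow> hereditary (\<M> k)"
    and "\<And>k. k \<ge> 1 \<Longrightarrow> spreading (\<M> k)"
    and "\<And>k. k \<ge> 1 \<Longrightarrow> 0 < \<theta> k \<and> \<theta> k < 1"
    and "\<And>k. k \<ge> 1 \<Longrightarrow> \<theta> (Suc k) \<le> \<theta> k"
    and "\<theta> \<longlonglongrightarrow> 0"
    and "schreier \<subseteq> \<M> 1"
  shows "(is_completion (T_M_norm \<M> \<theta>) J \<longrightarrow> reflexive TYPE('x)) \<and>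
         (\<forall>m\<ge>1. is_completion (T_Mm_norm m \<M> \<theta>) J \<longrightarrow> reflexive TYPE('x))"
proof (intro conjI allI impI)
  assume J: "is_completion (T_M_norm \<M> \<theta>) J"
  interpret tsirelson_completion \<M> \<theta> "\<lambda>k. allowable (\<M> k)" J
    using assms J by unfold_locales (auto simp: T_M_norm_def intro: allowable_restrict)
  show "reflexive TYPE('x)" by (rule reflexive_completion)
next
  fix m :: nat
  assume m: "1 \<le> m" and J: "is_completion (T_Mm_norm m \<M> \<theta>) J"
  interpret tsirelson_completion \<M> \<theta> "\<lambda>k. if k \<le> m then allowable (\<M> k) else admissible (\<M> k)" J
  proof unfold_locales
    show "allowable (\<M> k) Es"
      if "1 \<le> k" "(if k \<le> m then allowable (\<M> k) else admissible (\<M> k)) Es" for k Es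
      using that admissible_imp_allowable by (auto split: if_splits)
    show "(if k \<le> m then allowable (\<M> k) else admissible (\<M> k)) (restrict_sets A Es)"
      if "1 \<le> k" "(if k \<le> m then allowable (\<M> k) else admissible (\<M> k)) Es"
        "restrict_sets A Es \<noteq> []" for k Es A
      using that assms(3,4) allowable_restrict admissible_restrict by (auto split: if_splits)
  qed (use assms J m in \<open>auto simp: T_Mm_norm_def\<close>)
  show "reflexive TYPE('x)" by (rule reflexive_completion)
qed

end
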